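(* Assume the following. (1) For $\mu$-a.e. $s\in E$, the operator $A(s,\cdot)$ is maximal monotone; and for every $\lambda>0$ and $x\in\mathcal H$, the map $s\mapsto J_\lambda(s,x)$ is $\mathcal E/\mathcal B(\mathcal H)$-measurable. (2) $(\lambda_n)_{n\in\mathbb N}$ is a sequence of positive reals with $\sum_n\lambda_n=+\infty$ and $\sum_n\lambda_n^2<\infty$; the random variables $(\xi_n)_{n\ge1}$ are independent and identically distributed with distribution $\mu$. (3) The monotone operator $\underline A$ is maximal. (4) $\mathrm{zer}(\underline A)\neq\emptyset$ and $\mathrm{zer}(\underline A)\subset \mathcal Z_A(2)$. Let $x_0\in\mathcal H$ be fixed and let $(x_n)$ be the random sequence defined by $x_{n+1}=J_{\lambda_n}(\xi_{n+1},x_n)$, $n\in\mathbb N$, with weighted averages $\overline x_n=\sum_{k=1}^n\lambda_kx_k/\sum_{k=1}^n\lambda_k$. Let $G\in\mathcal F$ be an event such that for almost every $\omega\in G$ the sequence $(x_n(\omega))$ has the property $\overline{UI}$. Then, almost surely on $G$, $(\overline x_n)$ converges weakly to a point in $\mathrm{zer}(\underline A)$.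
   Context: $(E,\mathcal E,\mu)$ is a complete probability space, $\mathcal H$ is a separable Hilbert space with Borel $\sigma$-algebra $\mathcal B(\mathcal H)$, $A:E\times\mathcal H\to2^{\mathcal H}$ is a set-valued mapping, $(\Omega,\mathcal F,\mathbb P)$ is a probability space and $\xi_n:\Omega\to E$ ($n\ge1$) are random variables. For $\lambda>0$, $J_\lambda(s,x)=(I+\lambda A(s,\cdot))^{-1}(x)$ is the resolvent and $A_\lambda(s,x)=(x-J_\lambda(s,x))/\lambda$ the Yosida approximation (both single-valued and defined on all of $\mathcal H$ whenever $A(s,\cdot)$ is maximal monotone). For $x\in\mathcal H$ and $p\ge1$, $S_A^p(x)$ is the set of measurable functions $\phi:E\to\mathcal H$ with $\phi(s)\in A(s,x)$ for $\mu$-a.e. $s$ and $\int\|\phi\|^p d\mu<\infty$. The mean operator is the Aumann integral $\underline A(x)=\int A(s,x)\,d\mu(s)=\{\int\phi\,d\mu:\phi\in S_A^1(x)\}$ (Bochner integrals). $\mathrm{zer}(\underline A)=\{x: 0\in\underline A(x)\}$ and $\mathcal Z_A(p)=\{x\in\mathcal H:\exists\phi\in S_A^p(x),\ \int\phi\,d\mu=0\}$. A family $(f_i)_{i\in I}$ of measurable functions $E\to\mathbb R_+$ is uniformly integrable if $\lim_{a\to+\infty}\sup_i\int_{\{f_i>a\}}f_i\,d\mu=0$. A sequence $(u_n)_{n\ge1}$ in $\mathcal H$ has the property $\overline{UI}$ if the sequence of functions of $s$ given by $\frac{\sum_{k=1}^n\lambda_k\|A_{\lambda_k}(\cdot,u_k)\|}{\sum_{k=1}^n\lambda_k}$,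 $n\ge1$, is uniformly integrable. *)

theory Defs
  imports "HOL-Probability.Probability"
begin

text \<open>
  A real separable Hilbert space is a type of sort
  \<open>{real_inner, banach, second_countable_topology}\<close>.
  A set-valued operator on it is a function \<open>'h \<Rightarrow> 'h set\<close>.
\<close>

definition monotone_operator :: "('h::real_inner \<Rightarrow> 'h set) \<Rightarrow> bool" where
  "monotone_operator B \<longleftrightarrow> (\<forall>x y. \<forall>u\<in>B x. \<forall>v\<in>B y. 0 \<le> (u - v) \<bullet> (x - y))"

definition maximal_monotone :: "('h::real_inner \<Rightarrow> 'h set) \<Rightarrow> bool" where
  "maximal_monotone B \<longleftrightarrow> monotone_operator B \<and>
     (\<forall>C. monotone_operator C \<and> (\<forall>x. B x \<subseteq> C x) \<longrightarrow> C = B)"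

definition operator_inverse :: "('h \<Rightarrow> 'h set) \<Rightarrow> 'h \<Rightarrow> 'h set" where
  "operator_inverse B x = {y. x \<in> B y}"

text \<open>
  The value is meaningful whenever \<open>(I + l B)\<inverse>(x)\<close> is a singleton, in particular for
  maximal monotone \<open>B\<close> and \<open>l > 0\<close>; otherwise it is unspecified.
\<close>

definition resolvent :: "('h::real_inner \<Rightarrow> 'h set) \<Rightarrow> real \<Rightarrow> 'h \<Rightarrow> 'h" where
  "resolvent B l x = the_elem (operator_inverse (\<lambda>y. (\<lambda>v. y + l *\<^sub>R v) ` B y) x)"

definition yosida :: "('h::real_inner \<Rightarrow> 'h set) \<Rightarrow> real \<Rightarrow> 'h \<Rightarrow> 'h" where
  "yosida B l x = (x - resolvent B l x) /\<^sub>R l"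

definition zer :: "('h::zero \<Rightarrow> 'h set) \<Rightarrow> 'h set" where
  "zer B = {x. 0 \<in> B x}"

definition selections ::
  "'e measure \<Rightarrow> ('e \<Rightarrow> 'h::real_normed_vector \<Rightarrow> 'h set) \<Rightarrow> real \<Rightarrow> 'h \<Rightarrow> ('e \<Rightarrow> 'h) set" where
  "selections \<mu> A p x = {\<phi> \<in> borel_measurable \<mu>.
     (AE s in \<mu>. \<phi> s \<in> A s x) \<and> (\<integral>\<^sup>+ s. ennreal (norm (\<phi> s) powr p) \<partial>\<mu>) < \<infinity>}"

definition mean_operator ::
  "'e measure \<Rightarrow> ('e \<Rightarrow> 'h::{banach, second_countable_topology} \<Rightarrow> 'h set) \<Rightarrow> 'h \<Rightarrow> 'h set" where
  "mean_operator \<mu> A x = {(\<integral> s. \<phi> s \<partial>\<mu>) | \<phi>. \<phi> \<in> selections \<mu> A 1 x}"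

definition selection_zeros ::
  "'e measure \<Rightarrow> ('e \<Rightarrow> 'h::{banach, second_countable_topology} \<Rightarrow> 'h set) \<Rightarrow> real \<Rightarrow> 'h set" where
  "selection_zeros \<mu> A p = {x. \<exists>\<phi>\<in>selections \<mu> A p x. (\<integral> s. \<phi> s \<partial>\<mu>) = 0}"

definition uniformly_integrable :: "'e measure \<Rightarrow> 'i set \<Rightarrow> ('i \<Rightarrow> 'e \<Rightarrow> real) \<Rightarrow> bool" where
  "uniformly_integrable \<mu> I f \<longleftrightarrow>
     (\<forall>i\<in>I. f i \<in> borel_measurable \<mu> \<and> (\<forall>s\<in>space \<mu>. 0 \<le> f i s)) \<and>
     ((\<lambda>a::real. SUP i\<in>I. \<integral>\<^sup>+ s\<in>{s\<in>space \<mu>. a < f i s}. ennreal (f i s) \<partial>\<mu>) \<longlongrightarrow> 0) at_top"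

definition UI_bar ::
  "'e measure \<Rightarrow> ('e \<Rightarrow> 'h::real_inner \<Rightarrow> 'h set) \<Rightarrow> (nat \<Rightarrow> real) \<Rightarrow> (nat \<Rightarrow> 'h) \<Rightarrow> bool" where
  "UI_bar \<mu> A l u \<longleftrightarrow> uniformly_integrable \<mu> {1..}
     (\<lambda>n s. (\<Sum>k=1..n. l k * norm (yosida (A s) (l k) (u k))) / (\<Sum>k=1..n. l k))"

definition weighted_average ::
  "(nat \<Rightarrow> real) \<Rightarrow> (nat \<Rightarrow> 'h::real_vector) \<Rightarrow> nat \<Rightarrow> 'h" where
  "weighted_average l u n = (\<Sum>k=1..n. l k *\<^sub>R u k) /\<^sub>R (\<Sum>k=1..n. l k)"

definition weakly_converges :: "(nat \<Rightarrow> 'h::real_normed_vector) \<Rightarrow> 'h \<Rightarrow> bool" where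
  "weakly_converges u x \<longleftrightarrow>
     (\<forall>f::'h \<Rightarrow> real. bounded_linear f \<longrightarrow> (\<lambda>n. f (u n)) \<longlonglongrightarrow> f x)"

end

theory Submission
  imports Defs "HOL-Library.Diagonal_Subsequence"
begin

text \<open>
  One step of the iteration solves \<open>x\<^sub>n = x\<^sub>n\<^sub>+\<^sub>1 + \<lambda>\<^sub>n y\<close> with \<open>y \<in> A(\<xi>\<^sub>n\<^sub>+\<^sub>1, x\<^sub>n\<^sub>+\<^sub>1)\<close>.  Let \<open>z\<close> be a zero
  of the mean operator, witnessed by a square-integrable selection \<open>\<phi>\<close> of \<open>A(\<cdot>, z)\<close> with mean
  zero.  Monotonicity of \<open>A(\<xi>\<^sub>n\<^sub>+\<^sub>1, \<cdot>)\<close> gives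
  \<open>\<parallel>x\<^sub>n\<^sub>+\<^sub>1 - z\<parallel>\<^sup>2 + \<parallel>x\<^sub>n\<^sub>+\<^sub>1 - x\<^sub>n\<parallel>\<^sup>2/2 \<le> \<parallel>x\<^sub>n - z\<parallel>\<^sup>2 - 2\<lambda>\<^sub>n \<langle>\<phi>(\<xi>\<^sub>n\<^sub>+\<^sub>1), x\<^sub>n - z\<rangle> + 2\<lambda>\<^sub>n\<^sup>2\<parallel>\<phi>(\<xi>\<^sub>n\<^sub>+\<^sub>1)\<parallel>\<^sup>2\<close>
  (\<open>proximal_step_estimate\<close>).  The middle term is a martingale difference, the last one is
  summable in the mean.  Hence the second moments of the \<open>x\<^sub>n\<close> stay bounded, the expectations of
  \<open>\<parallel>x\<^sub>n\<^sub>+\<^sub>1 - x\<^sub>n\<parallel>\<^sup>2\<close> are summable, and the distances \<open>\<parallel>x\<^sub>n - z\<parallel>\<close> converge almost surely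
  (\<open>AE_distance_convergent\<close>).

  The limit points of the averages are found by a variational inequality.  Let \<open>v = \<integral>\<phi>\<close> with \<open>\<phi>\<close>
  an integrable selection of \<open>A(\<cdot>, u)\<close>.  For each \<open>s\<close>, monotonicity compares \<open>\<phi>(s)\<close> with the Yosida
  approximation of \<open>A(s, \<cdot>)\<close> at \<open>x\<^sub>k\<close>, which lies in \<open>A(s, J(s, x\<^sub>k))\<close>.  Average this with weights
  \<open>\<lambda>\<^sub>k\<close> and integrate over \<open>s\<close>.  What remains besides \<open>\<langle>v, u - average\<rangle>\<close> is controlled as follows:
  the drift sums \<open>\<Sum> \<lambda>\<^sub>k \<langle>\<integral>A\<^sub>\<lambda>(s, x\<^sub>k), x\<^sub>k - u\<rangle>\<close> are bounded above because they differ from a telescoping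
  sum by a convergent martingale (\<open>AE_drift_sums_bounded_above\<close>), and since \<open>\<phi>\<close> is only integrable,
  the region where it is large is handled by uniform integrability of the averaged Yosida norms.  So
  \<open>liminf \<langle>v, u - average\<rangle> \<ge> 0\<close> (\<open>ergodic_variational_inequality\<close>), and by maximality of the mean
  operator every weak limit point of the averages is one of its zeros.  Together with the convergence
  of the distances to all zeros, an argument of Opial type (\<open>ergodic_Opial\<close>) shows that there is only
  one such limit point.

  Three tools are developed on the way: Minty's theorem, which makes the resolvent defined everywhere
  and the Yosida approximation a selection of the operator (\<open>Minty\<close>, \<open>yosida_mem\<close>); weak
  sequential compactness in a separable Hilbert space (\<open>bounded_imp_weakly_convergent_subseq\<close>); and
  almost sure convergence of martingales with summable variances
  (\<open>martingale_series_AE_convergent\<close>).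
\<close>

section \<open>Hilbert spaces: nested convex sets, Riesz representation, weak compactness\<close>

text \<open>
  This replaces weak compactness of balls: nearly norm-minimal points of the sets form a Cauchy
  sequence, by the parallelogram law.  It yields norm-minimal elements, limits of weakly convergent
  sequences, and the passage from finite to countable families in Minty's theorem.
\<close>

lemma nested_closed_convex_nonempty_Inter:
  fixes C :: "nat \<Rightarrow> 'h::{real_inner, banach} set"
  assumes closed: "\<And>n. closed (C n)" and convex: "\<And>n. convex (C n)"
    and nonempty: "\<And>n. C n \<noteq> {}" and decseq: "decseq C" and bounded: "bounded (C 0)"
  shows "\<exists>x. \<forall>n. x \<in> C n"
proof -
  define d where "d n = (INF x\<in>C n. (norm x)\<^sup>2)" for n
  obtain B where B: "\<And>x. x \<in> C 0 \<Longrightarrow> norm x \<le> B"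
    using bounded by (auto simp: bounded_iff)
  have bdd: "bdd_below ((\<lambda>x. (norm x)\<^sup>2) ` S)" for S :: "'h set"
    by (rule bdd_belowI[of _ 0]) auto
  have sub: "C m \<subseteq> C n" if "n \<le> m" for n m
    using decseq that by (auto simp: decseq_def)
  have d_le: "d n \<le> (norm x)\<^sup>2" if "x \<in> C n" for n x
    unfolding d_def using that bdd by (intro cINF_lower)
  have d_mono: "incseq d"
    unfolding incseq_def d_def
    using sub nonempty bdd by (intro allI impI cINF_superset_mono) auto
  have d_bdd: "d n \<le> B\<^sup>2" for n
  proof -
    obtain x where x: "x \<in> C n" using nonempty by blast
    then have "norm x \<le> B" using sub[of 0 n] B by auto
    then show ?thesis using d_le[OF x] by (meson norm_ge_zero order_trans power_mono)
  qed
  obtain L where L: "d \<longlonglongrightarrow> L" "\<And>n. d n \<le> L"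
    using incseq_convergent[OF d_mono] d_bdd by metis
  have "\<exists>y. y \<in> C n \<and> (norm y)\<^sup>2 < d n + inverse (real (Suc n))" for n
    using cINF_less_iff[OF nonempty bdd, of n "d n + inverse (real (Suc n))"]
    by (auto simp: d_def)
  then obtain y where y: "\<And>n. y n \<in> C n"
    "\<And>n. (norm (y n))\<^sup>2 < d n + inverse (real (Suc n))"
    by metis
  \<comment> \<open>The midpoint of \<open>y n\<close> and \<open>y m\<close> stays in \<open>C n\<close>, so the parallelogram law
    bounds their distance by how much the squared norms exceed \<open>d n\<close>.\<close>
  define g where "g n = 2 * (L - d n) + 4 * inverse (real (Suc n))" for n
  have g: "(dist (y m) (y n))\<^sup>2 \<le> g n" if nm: "n \<le> m" for n m
  proof -
    have "y m \<in> C n" using y(1) sub[OF nm] by auto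
    then have "(1/2) *\<^sub>R y n + (1/2) *\<^sub>R y m \<in> C n"
      using convex[of n] y(1)[of n] by (auto simp: convex_def)
    then have "d n \<le> (norm ((1/2) *\<^sub>R y n + (1/2) *\<^sub>R y m))\<^sup>2" by (rule d_le)
    moreover have "(dist (y m) (y n))\<^sup>2 = 2 * (norm (y n))\<^sup>2 + 2 * (norm (y m))\<^sup>2
        - 4 * (norm ((1/2) *\<^sub>R y n + (1/2) *\<^sub>R y m))\<^sup>2"
      by (simp add: dist_norm power2_norm_eq_inner inner_simps inner_commute algebra_simps)
    moreover have "inverse (real (Suc m)) \<le> inverse (real (Suc n))"
      using nm by simp
    moreover have "d m \<le> L" by (rule L)
    ultimately have "(dist (y m) (y n))\<^sup>2 \<le> 2 * (norm (y n))\<^sup>2 + 2 * (norm (y m))\<^sup>2 - 4 * d n"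
      "inverse (real (Suc m)) \<le> inverse (real (Suc n))" "d m \<le> L" by auto
    then show ?thesis
      using y(2)[of n] y(2)[of m] unfolding g_def right_diff_distrib by linarith
  qed
  have "(\<lambda>n. 2 * (L - d n) + 4 * inverse (real (Suc n))) \<longlonglongrightarrow> 2 * (L - L) + 4 * 0"
    by (intro tendsto_intros L LIMSEQ_inverse_real_of_nat)
  then have g0: "g \<longlonglongrightarrow> 0" unfolding g_def by simp
  have "Cauchy y"
    unfolding Cauchy_altdef2
  proof (intro allI impI)
    fix e :: real assume e: "e > 0"
    then have "eventually (\<lambda>n. g n < e\<^sup>2) sequentially"
      using g0 by (intro order_tendstoD(2)[OF g0]) auto
    then obtain N where N: "g N < e\<^sup>2" by (auto simp: eventually_sequentially)
    show "\<exists>N. \<forall>n\<ge>N. dist (y n) (y N) < e"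
    proof (intro exI allI impI)
      fix n assume "N \<le> n"
      then have "(dist (y n) (y N))\<^sup>2 < e\<^sup>2" using g N by fastforce
      then show "dist (y n) (y N) < e" using e by (simp add: power_less_imp_less_base)
    qed
  qed
  then obtain x where x: "y \<longlonglongrightarrow> x" using Cauchy_convergent convergent_def by blast
  have "x \<in> C n" for n
  proof (rule Lim_in_closed_set[OF closed _ _ x])
    show "eventually (\<lambda>m. y m \<in> C n) sequentially"
      using sub y(1) by (auto simp: eventually_sequentially intro!: exI[of _ n])
  qed simp
  then show ?thesis by blast
qed

text \<open>
  The representing vector is a multiple of the norm-minimal point \<open>p\<close> of the hyperplane \<open>f = 1\<close>,
  because minimality makes \<open>p\<close> orthogonal to the kernel of \<open>f\<close>.
\<close>

lemma Riesz_representation: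
  fixes f :: "'h::{real_inner, banach} \<Rightarrow> real"
  assumes f: "bounded_linear f"
  shows "\<exists>g. \<forall>x. f x = g \<bullet> x"
proof (cases "\<forall>x. f x = 0")
  case True
  then show ?thesis by (intro exI[of _ 0]) auto
next
  case False
  interpret f: bounded_linear f by fact
  obtain x0 where "f x0 \<noteq> 0" using False by blast
  then have ne: "{y. f y = 1} \<noteq> {}"
    by (auto intro!: exI[of _ "x0 /\<^sub>R f x0"] simp: f.scaleR)
  define I where "I = (INF y\<in>{y. f y = 1}. (norm y)\<^sup>2)"
  define C where "C n = {y. f y = 1} \<inter> cball 0 (sqrt (I + inverse (real (Suc n))))" for n
  have bdd: "bdd_below ((\<lambda>x. (norm x)\<^sup>2) ` S)" for S :: "'h set"
    by (rule bdd_belowI[of _ 0]) auto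
  have I_le: "I \<le> (norm y)\<^sup>2" if "f y = 1" for y
    unfolding I_def using that bdd by (intro cINF_lower) auto
  have "\<exists>p. \<forall>n. p \<in> C n"
  proof (rule nested_closed_convex_nonempty_Inter)
    fix n
    have "closed (f -` {1})"
      using f.continuous_on[OF continuous_on_id]
      by (intro closed_vimage) auto
    then show "closed (C n)" unfolding C_def by (intro closed_Int) (auto simp: vimage_def)
    have "convex {y. f y = 1}" by (auto simp: convex_def f.add f.scaleR)
    then show "convex (C n)" unfolding C_def by (intro convex_Int) auto
    have "\<exists>y. f y = 1 \<and> (norm y)\<^sup>2 < I + inverse (real (Suc n))"
      using cINF_less_iff[OF ne bdd, of "I + inverse (real (Suc n))"] by (auto simp: I_def)
    then obtain y where "f y = 1" "(norm y)\<^sup>2 < I + inverse (real (Suc n))" by blast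
    then have "y \<in> C n" unfolding C_def by (auto intro!: real_le_rsqrt)
    then show "C n \<noteq> {}" by blast
  next
    show "decseq C" unfolding decseq_def C_def
      by (auto elim!: order_trans intro!: real_sqrt_le_mono le_imp_inverse_le)
    show "bounded (C 0)" unfolding C_def by (intro bounded_Int) auto
  qed
  then obtain p where p: "\<And>n. p \<in> C n" by blast
  have fp: "f p = 1" using p[of 0] by (simp add: C_def)
  have "norm p \<le> sqrt (I + inverse (real (Suc n)))" for n using p[of n] by (simp add: C_def)
  then have "(norm p)\<^sup>2 \<le> I + inverse (real (Suc n))" for n
    by (metis norm_ge_zero real_sqrt_le_iff real_sqrt_unique)
  moreover have "(\<lambda>n. I + inverse (real (Suc n))) \<longlonglongrightarrow> I + 0"
    by (intro tendsto_intros LIMSEQ_inverse_real_of_nat)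
  ultimately have pI: "(norm p)\<^sup>2 \<le> I" using LIMSEQ_le_const by fastforce
  have orth: "p \<bullet> k = 0" if k: "f k = 0" for k
  proof (rule ccontr)
    assume nz: "p \<bullet> k \<noteq> 0"
    then have "k \<noteq> 0" by auto
    then have kk: "k \<bullet> k > 0" by simp
    define t where "t = - (p \<bullet> k) / (k \<bullet> k)"
    have "f (p + t *\<^sub>R k) = 1" by (simp add: f.add f.scaleR fp k)
    then have "(norm p)\<^sup>2 \<le> (norm (p + t *\<^sub>R k))\<^sup>2" 
      using I_le[of "p + t *\<^sub>R k"] pI by linarith
    also have "\<dots> = (norm p)\<^sup>2 + 2 * t * (p \<bullet> k) + t * (t * (k \<bullet> k))"
      by (simp add: power2_norm_eq_inner inner_simps inner_commute algebra_simps)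
    also have "\<dots> = (norm p)\<^sup>2 - (p \<bullet> k)\<^sup>2 / (k \<bullet> k)"
      using kk by (simp add: t_def power2_eq_square field_simps)
    finally show False using kk nz by (simp add: divide_le_0_iff)
  qed
  have pp: "p \<bullet> p > 0" using fp by (metis f.zero inner_gt_zero_iff zero_neq_one)
  show ?thesis
  proof (intro exI allI)
    fix x
    have "p \<bullet> (x - f x *\<^sub>R p) = 0" by (rule orth) (simp add: f.diff f.scaleR fp)
    then show "f x = (p /\<^sub>R (p \<bullet> p)) \<bullet> x" using pp by (simp add: inner_simps field_simps)
  qed
qed

lemma weakly_converges_iff_inner:
  fixes u :: "nat \<Rightarrow> 'h::{real_inner, banach}"
  shows "weakly_converges u x \<longleftrightarrow> (\<forall>h. (\<lambda>n. u n \<bullet> h) \<longlonglongrightarrow> x \<bullet> h)"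
proof
  assume "weakly_converges u x"
  then show "\<forall>h. (\<lambda>n. u n \<bullet> h) \<longlonglongrightarrow> x \<bullet> h"
    unfolding weakly_converges_def using bounded_linear_inner_left by blast
next
  assume h: "\<forall>h. (\<lambda>n. u n \<bullet> h) \<longlonglongrightarrow> x \<bullet> h"
  show "weakly_converges u x" unfolding weakly_converges_def
  proof (intro allI impI)
    fix f :: "'h \<Rightarrow> real" assume "bounded_linear f"
    then obtain g where "\<And>x. f x = g \<bullet> x" using Riesz_representation by metis
    then show "(\<lambda>n. f (u n)) \<longlonglongrightarrow> f x" using h by (simp add: inner_commute)
  qed
qed

text \<open>
  A diagonal subsequence makes the inner products with a countable dense set, hence with every
  vector, converge.  The limit functional is represented by any point common to the closed convex
  hulls of the tails, since a half-space that contains a tail contains this point.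
\<close>

lemma bounded_imp_weakly_convergent_subseq:
  fixes u :: "nat \<Rightarrow> 'h::{real_inner, banach, second_countable_topology}"
  assumes "bounded (range u)"
  shows "\<exists>r x. strict_mono (r :: nat \<Rightarrow> nat) \<and> weakly_converges (u \<circ> r) x"
proof -
  obtain B where B: "\<And>n. norm (u n) \<le> B" using assms by (auto simp: bounded_iff)
  obtain D :: "'h set" where D: "countable D" "\<And>X. open X \<Longrightarrow> X \<noteq> {} \<Longrightarrow> \<exists>d\<in>D. d \<in> X"
    using countable_dense_setE by blast
  have "D \<noteq> {}" using D(2)[of UNIV] by auto
  define d where "d = from_nat_into D"
  have rd: "range d = D" using D(1) \<open>D \<noteq> {}\<close> by (simp add: d_def range_from_nat_into)
  define P where "P i r \<longleftrightarrow> convergent (\<lambda>n. u (r n) \<bullet> d i)" for i and r :: "nat \<Rightarrow> nat"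
  interpret subseqs P
  proof
    fix i and s :: "nat \<Rightarrow> nat" assume "strict_mono s"
    have "norm (u (s n) \<bullet> d i) \<le> B * norm (d i)" for n
      using Cauchy_Schwarz_ineq2[of "u (s n)" "d i"] B[of "s n"]
      by (metis mult_right_mono norm_ge_zero order_trans real_norm_def)
    then have "bounded (range (\<lambda>n. u (s n) \<bullet> d i))" by (auto simp: bounded_iff)
    then obtain l r where "strict_mono (r :: nat \<Rightarrow> nat)" "((\<lambda>n. u (s n) \<bullet> d i) \<circ> r) \<longlonglongrightarrow> l"
      using bounded_imp_convergent_subsequence by blast
    then show "\<exists>r'. strict_mono r' \<and> P i (s \<circ> r')"
      unfolding P_def convergent_def by (auto simp: o_def)
  qed
  define r where "r = diagseq"
  have r: "strict_mono r" unfolding r_def by (rule subseq_diagseq)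
  have conv_d: "convergent (\<lambda>n. u (r n) \<bullet> d i)" for i
  proof -
    have "P i (diagseq \<circ> ((+) (Suc i)))"
    proof (rule diagseq_holds)
      fix s r :: "nat \<Rightarrow> nat" and n assume "strict_mono r" "P n s"
      then show "P n (s \<circ> r)" unfolding P_def
        using convergent_subseq_convergent[of "\<lambda>m. u (s m) \<bullet> d n" r] by (simp add: o_def)
    qed
    then have "convergent (\<lambda>n. u (r (n + Suc i)) \<bullet> d i)"
      by (subst (asm) P_def) (simp add: r_def o_def add.commute)
    then show ?thesis
      using convergent_ignore_initial_segment[of "\<lambda>n. u (r n) \<bullet> d i" "Suc i"] by blast
  qed
  have conv: "convergent (\<lambda>n. u (r n) \<bullet> h)" for h
  proof -
    have "Cauchy (\<lambda>n. u (r n) \<bullet> h)" unfolding Cauchy_altdef2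
    proof (intro allI impI)
      fix e :: real assume e: "e > 0"
      define \<delta> where "\<delta> = e / (3 * (\<bar>B\<bar> + 1))"
      have \<delta>: "\<delta> > 0" using e by (simp add: \<delta>_def)
      obtain i where i: "dist (d i) h < \<delta>"
        using D(2)[of "ball h \<delta>"] \<delta> rd by (auto simp: dist_commute)
      have "B * dist (d i) h \<le> (\<bar>B\<bar> + 1) * \<delta>" using i \<delta> by (intro mult_mono) auto
      also have "\<dots> = e / 3" unfolding \<delta>_def by (simp add: field_simps)
      finally have small: "B * dist (d i) h \<le> e / 3" .
      have close: "\<bar>u (r n) \<bullet> h - u (r n) \<bullet> d i\<bar> \<le> e / 3" for n
      proof -
        have "\<bar>u (r n) \<bullet> (h - d i)\<bar> \<le> norm (u (r n)) * norm (h - d i)"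
          by (rule Cauchy_Schwarz_ineq2)
        also have "\<dots> \<le> B * norm (h - d i)" using B by (intro mult_right_mono) auto
        finally show ?thesis using small by (simp add: inner_simps dist_norm norm_minus_commute)
      qed
      have "Cauchy (\<lambda>n. u (r n) \<bullet> d i)" using conv_d convergent_Cauchy by blast
      then obtain N where N: "\<And>n. n \<ge> N \<Longrightarrow> dist (u (r n) \<bullet> d i) (u (r N) \<bullet> d i) < e / 3"
        unfolding Cauchy_altdef2 using e by (metis divide_pos_pos zero_less_numeral)
      show "\<exists>N. \<forall>n\<ge>N. dist (u (r n) \<bullet> h) (u (r N) \<bullet> h) < e"
      proof (intro exI allI impI)
        fix n assume "N \<le> n"
        then show "dist (u (r n) \<bullet> h) (u (r N) \<bullet> h) < e"
          using N[of n] close[of n] close[of N] unfolding dist_real_def by linarith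
      qed
    qed
    then show ?thesis by (rule Cauchy_convergent)
  qed
  \<comment> \<open>A point common to the closed convex hulls of all tails is the weak limit.\<close>
  define C where "C n = closure (convex hull (u ` r ` {n..}))" for n
  have "\<exists>x. \<forall>n. x \<in> C n"
  proof (rule nested_closed_convex_nonempty_Inter)
    show "decseq C" unfolding decseq_def C_def
      by (intro allI impI closure_mono hull_mono image_mono) auto
    have "bounded (u ` r ` {0..})" using B by (auto simp: bounded_iff)
    then show "bounded (C 0)" unfolding C_def
      by (intro bounded_closure bounded_convex_hull)
  qed (auto simp: C_def convex_closure)
  then obtain x where x: "\<And>n. x \<in> C n" by blast
  have "(\<lambda>n. (u \<circ> r) n \<bullet> h) \<longlonglongrightarrow> x \<bullet> h" for h
  proof -
    obtain l where l: "(\<lambda>n. u (r n) \<bullet> h) \<longlonglongrightarrow> l" using conv convergent_def by blast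
    have "\<bar>x \<bullet> h - l\<bar> \<le> e" if e: "e > 0" for e
    proof -
      obtain N where N: "\<And>n. n \<ge> N \<Longrightarrow> dist (u (r n) \<bullet> h) l < e"
        using l e by (meson lim_sequentially)
      define S where "S = {y. h \<bullet> y \<le> l + e} \<inter> {y. l - e \<le> h \<bullet> y}"
      have "u ` r ` {N..} \<subseteq> S"
      proof -
        have "u (r n) \<in> S" if "n \<ge> N" for n
        proof -
          have "\<bar>h \<bullet> u (r n) - l\<bar> < e" using N[OF that] by (simp add: dist_real_def inner_commute)
          then show ?thesis unfolding S_def by auto
        qed
        then show ?thesis by auto
      qed
      moreover have "convex S" "closed S"
        unfolding S_def using convex_halfspace_ge[of "l - e" h] closed_halfspace_ge[of "l - e" h]
        by (auto intro!: convex_Int closed_Int convex_halfspace_le closed_halfspace_le)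
      ultimately have "C N \<subseteq> S" unfolding C_def
        by (intro closure_minimal hull_minimal)
      then have "x \<in> S" using x by blast
      then show ?thesis unfolding S_def by (auto simp: inner_commute)
    qed
    then have "x \<bullet> h = l" by (metis abs_le_zero_iff dense_ge eq_iff_diff_eq_0)
    then show ?thesis using l by simp
  qed
  then show ?thesis using r weakly_converges_iff_inner by blast
qed

section \<open>Minty's theorem, resolvents and Yosida approximations\<close>

definition monotone_pairs :: "('h::real_inner \<times> 'h) set \<Rightarrow> bool" where
  "monotone_pairs S \<longleftrightarrow> (\<forall>(u, w)\<in>S. \<forall>(u', w')\<in>S. 0 \<le> (u - u') \<bullet> (w - w'))"

text \<open>
  For two pairs of a monotone set, \<open>\<langle>u - u', w - w'\<rangle> \<ge> 0\<close> becomes affine in each of the lifted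
  triples \<open>(u, w, \<langle>u, w\<rangle>)\<close> separately, so it survives passing to the convex hull first in one
  argument and then in the other.  On the diagonal it is the claim.
\<close>

lemma monotone_pairs_hull:
  fixes S :: "('h::real_inner \<times> 'h) set"
  assumes S: "monotone_pairs S"
    and p: "(u, w, q) \<in> convex hull ((\<lambda>(u, w). (u, w, u \<bullet> w)) ` S)"
  shows "u \<bullet> w \<le> q"
proof -
  define T where "T = (\<lambda>(u, w). (u, w, u \<bullet> w)) ` S"
  define related where "related p = {p'. - (snd (snd p)) \<le>
      (- fst (snd p), - fst p, 1::real) \<bullet> p'}" for p :: "'h \<times> 'h \<times> real"
  have related_iff: "p' \<in> related p \<longleftrightarrow>
      0 \<le> snd (snd p) - fst (snd p) \<bullet> fst p' - fst p \<bullet> fst (snd p') + snd (snd p')"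
    for p p' by (auto simp: related_def inner_prod_def)
  have sym: "p' \<in> related p \<longleftrightarrow> p \<in> related p'" for p p'
    unfolding related_iff by (simp add: inner_commute algebra_simps)
  have conv: "convex (related p)" for p
    unfolding related_def by (rule convex_halfspace_ge)
  have "T \<subseteq> related p" if "p \<in> T" for p
  proof
    fix p' assume "p' \<in> T"
    then obtain u' w' where "(u', w') \<in> S" "p' = (u', w', u' \<bullet> w')"
      unfolding T_def by auto
    moreover obtain u w where "(u, w) \<in> S" "p = (u, w, u \<bullet> w)"
      using \<open>p \<in> T\<close> unfolding T_def by auto
    moreover have "0 \<le> (u - u') \<bullet> (w - w')"
      using S \<open>(u, w) \<in> S\<close> \<open>(u', w') \<in> S\<close> unfolding monotone_pairs_def by blast
    ultimately show "p' \<in> related p"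
      by (simp add: related_iff inner_simps inner_commute algebra_simps)
  qed
  then have "convex hull T \<subseteq> related p" if "p \<in> T" for p
    using that conv by (intro hull_minimal) auto
  then have "T \<subseteq> related p" if "p \<in> convex hull T" for p
    using that sym by blast
  then have "convex hull T \<subseteq> related p" if "p \<in> convex hull T" for p
    using that conv by (intro hull_minimal) auto
  then have "(u, w, q) \<in> related (u, w, q)" using p unfolding T_def by blast
  then show ?thesis by (simp add: related_iff inner_commute)
qed

text \<open>
  Each pair restricts \<open>y\<close> to the ball with centre \<open>c = (u - w)/2\<close> and radius \<open>\<parallel>u + w\<parallel>/2\<close>, so the
  question is whether finitely many balls meet.  By duality a common point can be read off from the
  minimum of \<open>q + \<parallel>(u - w)/2\<parallel>\<^sup>2\<close> over the compact hull of the lifted triples \<open>(u, w, q)\<close>: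
  since \<open>q \<ge> \<langle>u, w\<rangle>\<close> on the hull, the minimum is nonnegative, and then first-order optimality in the
  direction of a given pair puts the centre \<open>y\<close> of the minimiser into the ball of this pair.
\<close>

lemma finite_monotone_pairs_extend:
  fixes S :: "('h::real_inner \<times> 'h) set"
  assumes S: "monotone_pairs S" and fin: "finite S"
  shows "\<exists>y. \<forall>(u, w)\<in>S. 0 \<le> (w + y) \<bullet> (u - y)"
proof (cases "S = {}")
  case False
  define T where "T = (\<lambda>(u, w). (u, w, u \<bullet> w)) ` S"
  define K where "K = convex hull T"
  define F :: "'h \<times> 'h \<times> real \<Rightarrow> real"
    where "F p = snd (snd p) + (norm ((1/2) *\<^sub>R (fst p - fst (snd p))))\<^sup>2" for p
  have "compact K" unfolding K_def T_def using fin by (intro finite_imp_compact_convex_hull) auto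
  moreover have "K \<noteq> {}" using False by (simp add: K_def T_def)
  moreover have "continuous_on K F" unfolding F_def by (intro continuous_intros)
  ultimately obtain p where p: "p \<in> K" "\<And>p'. p' \<in> K \<Longrightarrow> F p \<le> F p'"
    using continuous_attains_inf[of K F] by blast
  obtain u0 w0 q0 where p_eq: "p = (u0, w0, q0)" by (cases p) auto
  define y where "y = (1/2) *\<^sub>R (u0 - w0)"
  have Fp: "F p = q0 + y \<bullet> y" by (simp add: F_def p_eq y_def flip: power2_norm_eq_inner)
  have "u0 \<bullet> w0 \<le> q0"
    using monotone_pairs_hull[OF S] p(1) unfolding p_eq K_def T_def by blast
  moreover have "0 \<le> (u0 + w0) \<bullet> (u0 + w0)" by simp
  ultimately have Fp0: "0 \<le> F p" unfolding Fp y_def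
    by (simp add: inner_simps inner_commute algebra_simps)
  show ?thesis
  proof (intro exI[of _ y] ballI, clarify)
    fix u w assume uw: "(u, w) \<in> S"
    define c where "c = (1/2) *\<^sub>R (u - w)"
    define a where "a = u \<bullet> w - q0 + 2 * (y \<bullet> (c - y))"
    define b where "b = (c - y) \<bullet> (c - y)"
    have "(u, w, u \<bullet> w) \<in> K" unfolding K_def T_def using uw by (intro hull_inc) force
    have ineq: "0 \<le> a + t * b" if t: "0 < t" "t \<le> 1" for t
    proof -
      have "(1 - t) *\<^sub>R p + t *\<^sub>R (u, w, u \<bullet> w) \<in> K"
        using p(1) \<open>(u, w, u \<bullet> w) \<in> K\<close> t unfolding K_def
        by (intro convexD[OF convex_convex_hull]) auto
      then have "F p \<le> F ((1 - t) *\<^sub>R p + t *\<^sub>R (u, w, u \<bullet> w))" by (rule p(2))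
      also have "(1/2) *\<^sub>R ((1 - t) *\<^sub>R u0 + t *\<^sub>R u - ((1 - t) *\<^sub>R w0 + t *\<^sub>R w)) = y + t *\<^sub>R (c - y)"
        by (simp add: y_def c_def algebra_simps)
      then have "F ((1 - t) *\<^sub>R p + t *\<^sub>R (u, w, u \<bullet> w))
          = (1 - t) * q0 + t * (u \<bullet> w) + (y + t *\<^sub>R (c - y)) \<bullet> (y + t *\<^sub>R (c - y))"
        unfolding F_def p_eq by (simp add: power2_norm_eq_inner)
      also have "\<dots> = F p + t * (a + t * b)"
        unfolding Fp a_def b_def by (simp add: inner_simps inner_commute algebra_simps)
      finally show ?thesis using t by (simp add: zero_le_mult_iff)
    qed
    have "(\<lambda>n. a + inverse (real (Suc n)) * b) \<longlonglongrightarrow> a + 0 * b"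
      by (intro tendsto_intros LIMSEQ_inverse_real_of_nat)
    moreover have "0 \<le> a + inverse (real (Suc n)) * b" for n
      by (intro ineq) (auto simp: inverse_le_1_iff)
    ultimately have "0 \<le> a" using LIMSEQ_le_const by fastforce
    then have "0 \<le> u \<bullet> w + 2 * (y \<bullet> c) - y \<bullet> y"
      using Fp0 unfolding a_def Fp by (simp add: inner_simps)
    then show "0 \<le> (w + y) \<bullet> (u - y)"
      unfolding c_def by (simp add: inner_simps inner_commute algebra_simps)
  qed
qed auto

text \<open>
  For a countable dense subset the constraint sets are balls, so the nested intersection
  property applies to finite intersections.  The constraint is closed in the pair, hence density is
  enough.
\<close>

lemma monotone_pairs_extend:
  fixes S :: "('h::{real_inner, banach, second_countable_topology} \<times> 'h) set"
  assumes S: "monotone_pairs S"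
  shows "\<exists>y. \<forall>(u, w)\<in>S. 0 \<le> (w + y) \<bullet> (u - y)"
proof (cases "S = {}")
  case False
  obtain D where D: "countable D" "D \<subseteq> S" "S \<subseteq> closure D" using separable by blast
  have "D \<noteq> {}" using D False by auto
  define d where "d = from_nat_into D"
  have d: "d i \<in> D" for i unfolding d_def using from_nat_into[OF \<open>D \<noteq> {}\<close>] by blast
  have rd: "range d = D" using D(1) \<open>D \<noteq> {}\<close> by (simp add: d_def range_from_nat_into)
  define b where "b p = cball ((1/2) *\<^sub>R (fst p - snd p)) (norm ((1/2) *\<^sub>R (fst p + snd p)))"
    for p :: "'h \<times> 'h"
  have b_iff: "y \<in> b p \<longleftrightarrow> 0 \<le> (snd p + y) \<bullet> (fst p - y)" for y p
  proof -
    have "y \<in> b p \<longleftrightarrow> (norm ((1/2) *\<^sub>R (fst p - snd p) - y))\<^sup>2 \<le> (norm ((1/2) *\<^sub>R (fst p + snd p)))\<^sup>2"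
      unfolding b_def mem_cball dist_norm
      by (metis norm_ge_zero power2_le_imp_le power_mono)
    also have "\<dots> \<longleftrightarrow> 0 \<le> (snd p + y) \<bullet> (fst p - y)"
      unfolding power2_norm_eq_inner by (simp add: inner_simps inner_commute algebra_simps)
    finally show ?thesis .
  qed
  have rel: "0 \<le> (fst (d i) - fst (d j)) \<bullet> (snd (d i) - snd (d j))" for i j
  proof -
    have "d i \<in> S" "d j \<in> S" using d D(2) by auto
    then show ?thesis using S unfolding monotone_pairs_def case_prod_beta by blast
  qed
  have "\<exists>y. \<forall>n. y \<in> (\<Inter>i\<le>n. b (d i))"
  proof (rule nested_closed_convex_nonempty_Inter)
    fix n
    have "monotone_pairs (d ` {..n})"
      unfolding monotone_pairs_def case_prod_beta by (auto intro: rel)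
    then obtain y where y: "\<forall>(u, w)\<in>d ` {..n}. 0 \<le> (w + y) \<bullet> (u - y)"
      using finite_monotone_pairs_extend by blast
    then have "y \<in> b (d i)" if "i \<le> n" for i
      unfolding b_iff using that by (auto simp: case_prod_beta)
    then show "(\<Inter>i\<le>n. b (d i)) \<noteq> {}" by auto
  next
    show "decseq (\<lambda>n. \<Inter>i\<le>n. b (d i))" 
      unfolding decseq_def by (intro allI impI INT_anti_mono) auto
  qed (auto simp: b_def intro!: closed_INT convex_INT)
  then obtain y where y: "\<And>i. y \<in> b (d i)" by blast
  have "closed {p. 0 \<le> (snd p + y) \<bullet> (fst p - y)}"
    by (intro closed_Collect_le continuous_intros)
  moreover have "D \<subseteq> {p. 0 \<le> (snd p + y) \<bullet> (fst p - y)}"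
    using y rd b_iff by blast
  ultimately have "S \<subseteq> {p. 0 \<le> (snd p + y) \<bullet> (fst p - y)}"
    using D(3) closure_minimal by blast
  then show ?thesis by (intro exI[of _ y]) auto
qed auto

lemma maximal_monotoneD:
  assumes "maximal_monotone B" "u \<in> B x" "v \<in> B y"
  shows "0 \<le> (u - v) \<bullet> (x - y)"
  using assms unfolding maximal_monotone_def monotone_operator_def by blast

text \<open>
  Otherwise the graph of \<open>B\<close> could be enlarged by \<open>(y, p)\<close>.
\<close>

lemma maximal_monotone_memI:
  assumes B: "maximal_monotone B" and rel: "\<And>u v. v \<in> B u \<Longrightarrow> 0 \<le> (v - p) \<bullet> (u - y)"
  shows "p \<in> B y"
proof -
  define C where "C z = B z \<union> (if z = y then {p} else {})" for z
  have rel': "0 \<le> (p - v) \<bullet> (y - u)" if "v \<in> B u" for u v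
    using rel[OF that] by (simp add: inner_simps)
  have C: "v \<in> B z \<or> z = y \<and> v = p" if "v \<in> C z" for v z
    using that unfolding C_def by (auto split: if_splits)
  have "monotone_operator C" unfolding monotone_operator_def
  proof (intro allI ballI)
    fix z z' v v' assume "v \<in> C z" "v' \<in> C z'"
    then show "0 \<le> (v - v') \<bullet> (z - z')"
      using C[of v z] C[of v' z'] rel[of v z] rel'[of v' z'] maximal_monotoneD[OF B, of v z v' z']
      by auto
  qed
  then have "C = B" using B unfolding maximal_monotone_def C_def by blast
  moreover have "p \<in> C y" by (simp add: C_def)
  ultimately show ?thesis by simp
qed

text \<open>
  Adjoin to the shifted graph \<open>{(u, l v - x)}\<close> a point \<open>(y, -y)\<close>; then \<open>(y, (x - y)/l)\<close> is
  monotonically related to the graph of \<open>B\<close>, so by maximality it belongs to it.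
\<close>

theorem Minty:
  fixes B :: "'h::{real_inner, banach, second_countable_topology} \<Rightarrow> 'h set"
  assumes B: "maximal_monotone B" and l: "l > 0"
  shows "\<exists>y. \<exists>v\<in>B y. x = y + l *\<^sub>R v"
proof -
  define S where "S = {(u, l *\<^sub>R v - x) | u v. v \<in> B u}"
  have "0 \<le> (u - u') \<bullet> (v - v')" if "v \<in> B u" "v' \<in> B u'" for u u' v v'
    using maximal_monotoneD[OF B that] by (simp add: inner_commute)
  then have "monotone_pairs S"
    using l unfolding monotone_pairs_def S_def by (auto simp flip: scaleR_diff_right)
  then obtain y where y: "\<And>u w. (u, w) \<in> S \<Longrightarrow> 0 \<le> (w + y) \<bullet> (u - y)"
    using monotone_pairs_extend by blast
  have "(x - y) /\<^sub>R l \<in> B y"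
  proof (rule maximal_monotone_memI[OF B])
    fix u v assume "v \<in> B u"
    then have "0 \<le> (l *\<^sub>R v - x + y) \<bullet> (u - y)" using y unfolding S_def by blast
    also have "l *\<^sub>R v - x + y = l *\<^sub>R (v - (x - y) /\<^sub>R l)" using l by (simp add: algebra_simps)
    finally show "0 \<le> (v - (x - y) /\<^sub>R l) \<bullet> (u - y)" using l by (simp add: zero_le_mult_iff)
  qed
  then show ?thesis using l by (intro exI bexI[of _ "(x - y) /\<^sub>R l"]) auto
qed

context
  fixes B :: "'h::{real_inner, banach, second_countable_topology} \<Rightarrow> 'h set" and l :: real
  assumes B: "maximal_monotone B" and l: "l > 0"
begin

lemma resolvent_eqI:
  assumes v: "v \<in> B y"
  shows "resolvent B l (y + l *\<^sub>R v) = y"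
proof -
  have "y' = y" if v': "v' \<in> B y'" and eq: "y + l *\<^sub>R v = y' + l *\<^sub>R v'" for y' v'
  proof -
    have "y' - y = l *\<^sub>R (v - v')" using eq by (simp add: algebra_simps)
    moreover have "0 \<le> (v - v') \<bullet> (y - y')" by (rule maximal_monotoneD[OF B v v'])
    moreover have "y - y' = - (y' - y)" by simp
    ultimately have "0 \<le> - ((v - v') \<bullet> (l *\<^sub>R (v - v')))"
      by (simp only: inner_minus_right)
    then have "(v - v') \<bullet> (v - v') \<le> 0" using l by (simp add: mult_le_0_iff)
    then have "v - v' = 0" by (metis inner_eq_zero_iff inner_ge_zero order_antisym)
    then show ?thesis using \<open>y' - y = l *\<^sub>R (v - v')\<close> by simp
  qed
  then have "operator_inverse (\<lambda>y. (\<lambda>v. y + l *\<^sub>R v) ` B y) (y + l *\<^sub>R v) = {y}"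
    using v unfolding operator_inverse_def by blast
  then show ?thesis by (simp add: resolvent_def)
qed

lemma yosida_mem: "yosida B l x \<in> B (resolvent B l x)"
proof -
  obtain y v where v: "v \<in> B y" and x: "x = y + l *\<^sub>R v" using Minty[OF B l] by blast
  then have "resolvent B l x = y" using resolvent_eqI by blast
  then show ?thesis using v x l by (simp add: yosida_def)
qed

lemma resolvent_eq_yosida: "resolvent B l x = x - l *\<^sub>R yosida B l x"
  using l by (simp add: yosida_def)

lemma resolvent_nonexpansive: "norm (resolvent B l x - resolvent B l y) \<le> norm (x - y)"
proof -
  define a where "a = resolvent B l x - resolvent B l y"
  define b where "b = yosida B l x - yosida B l y"
  have ab: "0 \<le> b \<bullet> a"
    unfolding a_def b_def by (intro maximal_monotoneD[OF B] yosida_mem)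
  have "x - y = a + l *\<^sub>R b" using resolvent_eq_yosida by (simp add: a_def b_def algebra_simps)
  then have "(norm (x - y))\<^sup>2 = (norm a)\<^sup>2 + 2 * l * (b \<bullet> a) + l * (l * (b \<bullet> b))"
    by (simp add: power2_norm_eq_inner inner_simps inner_commute algebra_simps)
  moreover have "0 \<le> 2 * l * (b \<bullet> a)" "0 \<le> l * (l * (b \<bullet> b))" using ab l by auto
  ultimately have "(norm a)\<^sup>2 \<le> (norm (x - y))\<^sup>2" by linarith
  then show ?thesis unfolding a_def by (rule power2_le_imp_le) simp
qed

text \<open>
  At \<open>z\<close> monotonicity bounds the Yosida approximation by any element of \<open>B z\<close>; elsewhere the
  Lipschitz bound \<open>2 \<parallel>x - z\<parallel> / l\<close> is added.  This makes \<open>s \<mapsto> A\<^sub>\<lambda>(s, x)\<close> integrable as soon as one integrable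
  selection of \<open>A\<close> exists at a single point.
\<close>

lemma norm_yosida_le:
  assumes v: "v \<in> B z"
  shows "norm (yosida B l x) \<le> norm v + 2 * norm (x - z) / l"
proof -
  define a where "a = yosida B l z"
  have "0 \<le> (v - a) \<bullet> (z - resolvent B l z)"
    unfolding a_def by (intro maximal_monotoneD[OF B] v yosida_mem)
  also have "z - resolvent B l z = l *\<^sub>R a" unfolding a_def using resolvent_eq_yosida by simp
  finally have "a \<bullet> a \<le> v \<bullet> a" using l by (simp add: inner_simps zero_le_mult_iff)
  also have "\<dots> \<le> norm v * norm a" by (rule norm_cauchy_schwarz)
  finally have "norm a * norm a \<le> norm v * norm a" by (simp add: power2_norm_eq_inner[symmetric] power2_eq_square)
  then have av: "norm a \<le> norm v" by (cases "norm a = 0") auto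
  have "yosida B l x - a = ((x - z) - (resolvent B l x - resolvent B l z)) /\<^sub>R l"
    unfolding a_def yosida_def by (simp add: algebra_simps)
  also have "norm \<dots> \<le> (norm (x - z) + norm (x - z)) / l"
    using l resolvent_nonexpansive[of x z] norm_triangle_ineq4[of "x - z" "resolvent B l x - resolvent B l z"]
    by (simp add: divide_simps)
  finally have "norm (yosida B l x - a) \<le> 2 * norm (x - z) / l" by simp
  then show ?thesis using av norm_triangle_sub[of "yosida B l x" a] by linarith
qed

end

section \<open>Square-integrable martingales driven by independent innovations\<close>

lemma integrable_mult_squares:
  fixes f g :: "'a \<Rightarrow> real"
  assumes [measurable]: "f \<in> borel_measurable M" "g \<in> borel_measurable M"
    and "integrable M (\<lambda>x. (f x)\<^sup>2)" "integrable M (\<lambda>x. (g x)\<^sup>2)"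
  shows "integrable M (\<lambda>x. f x * g x)"
proof (rule Bochner_Integration.integrable_bound)
  show "integrable M (\<lambda>x. (f x)\<^sup>2 + (g x)\<^sup>2)" using assms by simp
  have "\<bar>f x * g x\<bar> \<le> (f x)\<^sup>2 + (g x)\<^sup>2" for x
  proof -
    have "0 \<le> \<bar>f x\<bar> * \<bar>g x\<bar>" by simp
    then show ?thesis using sum_squares_bound[of "\<bar>f x\<bar>" "\<bar>g x\<bar>"]
      unfolding abs_mult power2_abs by linarith
  qed
  then show "AE x in M. norm (f x * g x) \<le> norm ((f x)\<^sup>2 + (g x)\<^sup>2)" by simp
qed measurable

text \<open>
  The hypothesis \<open>orth\<close> is the martingale property without conditional expectations.  Kolmogorov's
  maximal inequality bounds the probability that the partial sums oscillate by more than \<open>e\<close> after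
  time \<open>m\<close> by \<open>e\<^sup>-\<^sup>2\<close> times the tail of the variance series; hence the partial sums are almost
  surely Cauchy.
\<close>

theorem (in prob_space) martingale_series_AE_convergent:
  fixes D :: "nat \<Rightarrow> 'a \<Rightarrow> real" and F :: "nat \<Rightarrow> 'a measure"
  assumes sub: "\<And>n. subalgebra M (F n)" and mono: "\<And>m n. m \<le> n \<Longrightarrow> subalgebra (F n) (F m)"
    and adapted: "\<And>n. D n \<in> borel_measurable (F (Suc n))"
    and sq: "\<And>n. integrable M (\<lambda>\<omega>. (D n \<omega>)\<^sup>2)"
    and orth: "\<And>n W. W \<in> borel_measurable (F n) \<Longrightarrow> integrable M (\<lambda>\<omega>. W \<omega> * D n \<omega>) \<Longrightarrow>
      (\<integral>\<omega>. W \<omega> * D n \<omega> \<partial>M) = 0"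
    and summable: "summable (\<lambda>n. \<integral>\<omega>. (D n \<omega>)\<^sup>2 \<partial>M)"
  shows "AE \<omega> in M. convergent (\<lambda>n. \<Sum>k<n. D k \<omega>)"
proof -
  have sp: "space (F n) = space M" for n using sub[of n] by (simp add: subalgebra_def)
  have Dm: "D k \<in> borel_measurable (F n)" if "k < n" for k n
    using measurable_from_subalg[OF mono[of "Suc k" n]] adapted that by auto
  have DM [measurable]: "D k \<in> borel_measurable M" for k
    using measurable_from_subalg[OF sub] adapted by blast
  define S where "S n \<omega> = (\<Sum>k<n. D k \<omega>)" for n \<omega>
  have Sm: "S k \<in> borel_measurable (F n)" if "k \<le> n" for k n
    unfolding S_def using that by (intro borel_measurable_sum Dm) auto
  have SM [measurable]: "S n \<in> borel_measurable M" for n unfolding S_def by measurable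
  define V where "V n = (\<integral>\<omega>. (D n \<omega>)\<^sup>2 \<partial>M)" for n
  have V0: "0 \<le> V n" for n unfolding V_def by simp
  define tail where "tail m = (\<Sum>k. V (k + m))" for m
  have tail0: "tail \<longlonglongrightarrow> 0"
    unfolding tail_def using summable by (intro suminf_exist_split2) (simp add: V_def)
  have tail_ge: "(\<Sum>k=m..<N. V k) \<le> tail m" for m N
  proof (cases "m \<le> N")
    case True
    have "(\<Sum>k=m..<N. V k) = (\<Sum>k<N - m. V (k + m))"
      using sum.shift_bounds_nat_ivl[of V 0 m "N - m"] True by (simp add: atLeast0LessThan)
    also have "\<dots> \<le> tail m" unfolding tail_def
      using summable V0 by (intro sum_le_suminf) (auto simp: V_def[symmetric] summable_iff_shift)
    finally show ?thesis .
  next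
    case False
    then show ?thesis unfolding tail_def
      using summable V0 by (auto intro!: suminf_nonneg simp: V_def[symmetric] summable_iff_shift)
  qed
  have maximal: "prob {\<omega>\<in>space M. \<exists>n\<in>{m..N}. e < \<bar>S n \<omega> - S m \<omega>\<bar>} \<le> tail m / e\<^sup>2"
    if e: "e > 0" and mN: "m \<le> N" for m N and e :: real
  proof -
    \<comment> \<open>Multiplication by \<open>I\<close> stops the sum, keeps orthogonality, and freezes \<open>T\<close> at a value
      of modulus at least \<open>e\<close> once this bound has been exceeded.\<close>
    define I :: "nat \<Rightarrow> 'a \<Rightarrow> real"
      where "I k \<omega> = (if \<forall>n\<in>{m..k}. \<bar>S n \<omega> - S m \<omega>\<bar> \<le> e then 1 else 0)" for k \<omega>
    define T where "T n \<omega> = (\<Sum>k=m..<n. I k \<omega> * D k \<omega>)" for n \<omega>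
    have Im: "I k \<in> borel_measurable (F k)" if "m \<le> k" for k
    proof -
      have [measurable]: "S n \<in> borel_measurable (F k)" if "n \<in> {m..k}" for n
        using that by (intro Sm) auto
      have [measurable]: "S m \<in> borel_measurable (F k)" using that by (intro Sm) auto
      show ?thesis unfolding I_def by measurable
    qed
    have IM [measurable]: "I k \<in> borel_measurable M" for k
      unfolding I_def by measurable
    have TM [measurable]: "T n \<in> borel_measurable M" for n unfolding T_def by measurable
    have Tm: "T n \<in> borel_measurable (F n)" if "m \<le> n" for n
    proof -
      have "I k \<in> borel_measurable (F n)" if "k \<in> {m..<n}" for k
        using measurable_from_subalg[OF mono[of k n]] Im[of k] that by auto
      then show ?thesis unfolding T_def
        by (intro borel_measurable_sum borel_measurable_times Dm) auto
    qed
    have stopped: "(I n \<omega> = 1 \<longrightarrow> T n \<omega> = S n \<omega> - S m \<omega>) \<and> (I n \<omega> = 0 \<longrightarrow> e \<le> \<bar>T n \<omega>\<bar>)"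
      if "m \<le> n" for n \<omega>
      using that
    proof (induction n rule: dec_induct)
      case base
      then show ?case using e by (auto simp: I_def T_def)
    next
      case (step n)
      have T: "T (Suc n) \<omega> = T n \<omega> + I n \<omega> * D n \<omega>" using step.hyps unfolding T_def by simp
      have S: "S (Suc n) \<omega> = S n \<omega> + D n \<omega>" unfolding S_def by simp
      have I: "I (Suc n) \<omega> = (if I n \<omega> = 1 \<and> \<bar>S (Suc n) \<omega> - S m \<omega>\<bar> \<le> e then 1 else 0)"
        using step.hyps unfolding I_def by (auto simp: le_Suc_eq)
      have "I n \<omega> = 0 \<or> I n \<omega> = 1" unfolding I_def by auto
      then show ?case using step.IH unfolding T S I by auto
    qed
    have bound: "integrable M (\<lambda>\<omega>. (T n \<omega>)\<^sup>2) \<and> (\<integral>\<omega>. (T n \<omega>)\<^sup>2 \<partial>M) \<le> (\<Sum>k=m..<n. V k)"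
      if "m \<le> n" for n
      using that
    proof (induction n rule: dec_induct)
      case base
      then show ?case by (simp add: T_def)
    next
      case (step n)
      have T: "T (Suc n) \<omega> = T n \<omega> + I n \<omega> * D n \<omega>" for \<omega> using step.hyps unfolding T_def by simp
      have I01: "\<bar>I n \<omega>\<bar> \<le> 1" "I n \<omega> * I n \<omega> = I n \<omega>" "0 \<le> I n \<omega>" for \<omega> unfolding I_def by auto
      have I_le: "I n \<omega> * x \<le> x" if "0 \<le> x" for \<omega> x
        using mult_right_mono[OF order_trans[OF abs_ge_self I01(1)[of \<omega>]] that] by simp
      have i2: "integrable M (\<lambda>\<omega>. I n \<omega> * (D n \<omega>)\<^sup>2)"
        by (rule Bochner_Integration.integrable_bound[OF sq[of n]])
          (use I_le I01 in \<open>auto simp: abs_mult\<close>)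
      have TI: "(T n \<omega> * I n \<omega>)\<^sup>2 \<le> (T n \<omega>)\<^sup>2" for \<omega>
      proof -
        have "(T n \<omega> * I n \<omega>)\<^sup>2 = (I n \<omega> * I n \<omega>) * (T n \<omega>)\<^sup>2"
          by (simp add: power2_eq_square algebra_simps)
        then show ?thesis using I_le by (simp add: I01(2))
      qed
      have W2: "integrable M (\<lambda>\<omega>. (T n \<omega> * I n \<omega>)\<^sup>2)"
        by (rule Bochner_Integration.integrable_bound[OF conjunct1[OF step.IH]])
          (use TI in auto)
      have i1: "integrable M (\<lambda>\<omega>. T n \<omega> * I n \<omega> * D n \<omega>)"
        by (rule integrable_mult_squares[OF _ _ W2 sq]) measurable
      have z: "(\<integral>\<omega>. T n \<omega> * I n \<omega> * D n \<omega> \<partial>M) = 0"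
        using step.hyps by (intro orth i1 borel_measurable_times Tm Im) auto
      have eq: "(T (Suc n) \<omega>)\<^sup>2 = (T n \<omega>)\<^sup>2 + 2 * (T n \<omega> * I n \<omega> * D n \<omega>) + I n \<omega> * (D n \<omega>)\<^sup>2" for \<omega>
      proof -
        have "(T (Suc n) \<omega>)\<^sup>2
            = (T n \<omega>)\<^sup>2 + 2 * (T n \<omega> * I n \<omega> * D n \<omega>) + (I n \<omega> * I n \<omega>) * (D n \<omega>)\<^sup>2"
          unfolding T by (simp add: power2_eq_square algebra_simps)
        then show ?thesis by (simp only: I01(2))
      qed
      have "(\<integral>\<omega>. (T (Suc n) \<omega>)\<^sup>2 \<partial>M) = (\<integral>\<omega>. (T n \<omega>)\<^sup>2 \<partial>M) + (\<integral>\<omega>. I n \<omega> * (D n \<omega>)\<^sup>2 \<partial>M)"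
        unfolding eq using step.IH i1 i2 z by simp
      also have "\<dots> \<le> (\<Sum>k=m..<n. V k) + V n"
        unfolding V_def using step.IH i2 sq I_le
        by (intro add_mono integral_mono) (auto simp: V_def)
      finally show ?case unfolding eq using step.IH i1 i2 step.hyps by simp
    qed
    have le: "1 - I N \<omega> \<le> (T N \<omega>)\<^sup>2 / e\<^sup>2" for \<omega>
    proof (cases "I N \<omega> = 0")
      case True
      then have "e\<^sup>2 \<le> (T N \<omega>)\<^sup>2" using stopped[OF mN] e
        by (metis abs_le_square_iff abs_of_pos)
      then show ?thesis using True e by simp
    next
      case False
      then have "I N \<omega> = 1" unfolding I_def by (auto split: if_splits)
      then show ?thesis by simp
    qed
    have ind: "indicator {\<omega>\<in>space M. \<exists>n\<in>{m..N}. e < \<bar>S n \<omega> - S m \<omega>\<bar>} \<omega> = 1 - I N \<omega>"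
      if "\<omega> \<in> space M" for \<omega>
      using that unfolding I_def indicator_def by (auto simp: not_le)
    have [simp]: "integrable M (I N)"
      by (rule integrable_const_bound[where B=1]) (auto simp: I_def)
    have "prob {\<omega>\<in>space M. \<exists>n\<in>{m..N}. e < \<bar>S n \<omega> - S m \<omega>\<bar>} = (\<integral>\<omega>. 1 - I N \<omega> \<partial>M)"
      by (subst Bochner_Integration.integral_cong[OF refl ind[symmetric]]) auto
    also have "\<dots> \<le> (\<integral>\<omega>. (T N \<omega>)\<^sup>2 / e\<^sup>2 \<partial>M)"
      using bound[OF mN] le by (intro integral_mono) auto
    also have "\<dots> \<le> tail m / e\<^sup>2"
      using bound[OF mN] tail_ge[of m N] by (auto intro!: divide_right_mono)
    finally show ?thesis .
  qed
  have AE_e: "AE \<omega> in M. \<exists>m. \<forall>n\<ge>m. \<bar>S n \<omega> - S m \<omega>\<bar> \<le> e" if e: "e > 0" for e :: real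
  proof -
    define U where "U m = {\<omega>\<in>space M. \<exists>n\<ge>m. e < \<bar>S n \<omega> - S m \<omega>\<bar>}" for m
    have [measurable]: "U m \<in> events" for m unfolding U_def by measurable
    have U: "prob (U m) \<le> tail m / e\<^sup>2" for m
    proof -
      define B where "B N = {\<omega>\<in>space M. \<exists>n\<in>{m..m+N}. e < \<bar>S n \<omega> - S m \<omega>\<bar>}" for N
      have "(\<lambda>N. prob (B N)) \<longlonglongrightarrow> prob (\<Union>N. B N)"
        by (rule finite_Lim_measure_incseq) (auto simp: B_def incseq_def intro: le_trans)
      moreover have "(\<Union>N. B N) = U m"
      proof
        show "U m \<subseteq> (\<Union>N. B N)"
        proof
          fix \<omega> assume "\<omega> \<in> U m"
          then obtain n where "n \<ge> m" "\<omega> \<in> space M" "e < \<bar>S n \<omega> - S m \<omega>\<bar>" unfolding U_def by blast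
          then have "\<omega> \<in> B n" unfolding B_def by auto
          then show "\<omega> \<in> (\<Union>N. B N)" by blast
        qed
      qed (auto simp: U_def B_def)
      moreover have "prob (B N) \<le> tail m / e\<^sup>2" for N
        unfolding B_def by (rule maximal[OF e]) simp
      ultimately show ?thesis using LIMSEQ_le_const2 by metis
    qed
    have "(\<lambda>m. tail m / e\<^sup>2) \<longlonglongrightarrow> 0 / e\<^sup>2" by (intro tendsto_intros tail0) (use e in auto)
    moreover have "prob (\<Inter>m. U m) \<le> tail m / e\<^sup>2" for m
      by (rule order_trans[OF finite_measure_mono U[of m]]) auto
    ultimately have "prob (\<Inter>m. U m) \<le> 0" using LIMSEQ_le_const by fastforce
    then have "prob (\<Inter>m. U m) = 0" using measure_nonneg[of M "\<Inter>m. U m"] by linarith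
    then have "(\<Inter>m. U m) \<in> null_sets M" by (auto simp: emeasure_eq_measure)
    then show ?thesis
      by (rule AE_I') (auto simp: U_def not_le)
  qed
  have "AE \<omega> in M. \<forall>j. \<exists>m. \<forall>n\<ge>m. \<bar>S n \<omega> - S m \<omega>\<bar> \<le> inverse (real (Suc j))"
    unfolding AE_all_countable by (intro allI AE_e) simp
  then show ?thesis
  proof eventually_elim
    case (elim \<omega>)
    have "Cauchy (\<lambda>n. S n \<omega>)" unfolding Cauchy_altdef2
    proof (intro allI impI)
      fix e :: real assume "e > 0"
      then obtain j where "inverse (real (Suc j)) < e" using reals_Archimedean by blast
      then show "\<exists>N. \<forall>n\<ge>N. dist (S n \<omega>) (S N \<omega>) < e"
        using elim unfolding dist_real_def by (meson le_less_trans)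
    qed
    then show ?case using Cauchy_convergent by (simp add: S_def)
  qed
qed

text \<open>
  Independence is stated between \<open>F n\<close> and the next innovation as events, since the identity on
  the sample space and \<open>\<xi>\<close> have different types.
\<close>

locale innovations = prob_space P + mu: prob_space \<mu> for P :: "'w measure" and \<mu> :: "'e measure" +
  fixes F :: "nat \<Rightarrow> 'w measure" and \<xi> :: "nat \<Rightarrow> 'w \<Rightarrow> 'e"
  assumes subalgebra: "\<And>n. subalgebra P (F n)"
    and filtration: "\<And>m n. m \<le> n \<Longrightarrow> subalgebra (F n) (F m)"
    and innovation_adapted: "\<And>n. \<xi> (Suc n) \<in> measurable (F (Suc n)) \<mu>"
    and innovation_law: "\<And>n. distr P \<mu> (\<xi> (Suc n)) = \<mu>"
    and innovation_indep: "\<And>n A B. A \<in> sets (F n) \<Longrightarrow> B \<in> sets \<mu> \<Longrightarrow>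
      measure P (A \<inter> (\<xi> (Suc n) -` B \<inter> space P)) = measure P A * measure \<mu> B"
begin

lemma space_F: "space (F n) = space P"
  using subalgebra[of n] by (simp add: subalgebra_def)

lemma innovation_measurable [measurable]: "\<xi> (Suc n) \<in> measurable P \<mu>"
  using measurable_from_subalg[OF subalgebra innovation_adapted] .

lemma id_measurable_F: "(\<lambda>\<omega>. \<omega>) \<in> measurable P (F n)"
  using subalgebra[of n] by (auto simp: subalgebra_def measurable_def Int_absorb2 sets.sets_into_space)

lemma measurable_F_imp_P: "f \<in> measurable (F n) N \<Longrightarrow> f \<in> measurable P N"
  using measurable_from_subalg[OF subalgebra] .

lemma measurable_F_mono: "f \<in> measurable (F m) N \<Longrightarrow> m \<le> n \<Longrightarrow> f \<in> measurable (F n) N"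
  using measurable_from_subalg[OF filtration] .

lemma pair_innovation_measurable:
  "(\<lambda>\<omega>. (\<omega>, \<xi> (Suc n) \<omega>)) \<in> measurable P (F n \<Otimes>\<^sub>M \<mu>)"
  by (intro measurable_Pair id_measurable_F) measurable

text \<open>
  Seen through the sigma-algebra \<open>F n\<close>, the sample point and the next innovation are independent.
  Fubini's theorem for this product law plays the part of conditioning on \<open>F n\<close>.
\<close>

lemma pair_innovation_law:
  "distr P (F n \<Otimes>\<^sub>M \<mu>) (\<lambda>\<omega>. (\<omega>, \<xi> (Suc n) \<omega>)) = distr P (F n) (\<lambda>\<omega>. \<omega>) \<Otimes>\<^sub>M \<mu>"
proof -
  interpret d: prob_space "distr P (F n) (\<lambda>\<omega>. \<omega>)" by (rule prob_space_distr[OF id_measurable_F])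
  show ?thesis
  proof (rule pair_measure_eqI[symmetric])
    fix A B assume A: "A \<in> sets (distr P (F n) (\<lambda>\<omega>. \<omega>))" and B: "B \<in> sets \<mu>"
    have AP: "A \<in> sets P" "A \<subseteq> space P"
      using A subalgebra[of n] sets.sets_into_space[of A P] by (auto simp: subalgebra_def)
    have "(\<lambda>\<omega>. (\<omega>, \<xi> (Suc n) \<omega>)) -` (A \<times> B) \<inter> space P = A \<inter> (\<xi> (Suc n) -` B \<inter> space P)"
      by auto
    then have "emeasure (distr P (F n \<Otimes>\<^sub>M \<mu>) (\<lambda>\<omega>. (\<omega>, \<xi> (Suc n) \<omega>))) (A \<times> B)
        = ennreal (measure P A * measure \<mu> B)"
      using A B innovation_indep[of A n B]
      by (subst emeasure_distr[OF pair_innovation_measurable]) (auto simp: emeasure_eq_measure)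
    moreover have "emeasure (distr P (F n) (\<lambda>\<omega>. \<omega>)) A = ennreal (measure P A)"
      using A AP by (subst emeasure_distr[OF id_measurable_F]) (auto simp: emeasure_eq_measure Int_absorb2)
    ultimately show "emeasure (distr P (F n) (\<lambda>\<omega>. \<omega>)) A * emeasure \<mu> B
        = emeasure (distr P (F n \<Otimes>\<^sub>M \<mu>) (\<lambda>\<omega>. (\<omega>, \<xi> (Suc n) \<omega>))) (A \<times> B)"
      by (simp add: mu.emeasure_eq_measure ennreal_mult)
  next
    have "sets (distr P (F n) (\<lambda>\<omega>. \<omega>) \<Otimes>\<^sub>M \<mu>) = sets (F n \<Otimes>\<^sub>M \<mu>)"
      by (rule sets_pair_measure_cong) simp_all
    then show "sets (distr P (F n) (\<lambda>\<omega>. \<omega>) \<Otimes>\<^sub>M \<mu>)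
        = sets (distr P (F n \<Otimes>\<^sub>M \<mu>) (\<lambda>\<omega>. (\<omega>, \<xi> (Suc n) \<omega>)))" by simp
  qed (rule d.sigma_finite_measure_axioms mu.sigma_finite_measure_axioms)+
qed

lemma nn_integral_innovation:
  assumes h [measurable]: "h \<in> borel_measurable (F n \<Otimes>\<^sub>M \<mu>)"
  shows "(\<integral>\<^sup>+\<omega>. h (\<omega>, \<xi> (Suc n) \<omega>) \<partial>P) = (\<integral>\<^sup>+\<omega>. (\<integral>\<^sup>+s. h (\<omega>, s) \<partial>\<mu>) \<partial>P)"
proof -
  have "(\<integral>\<^sup>+\<omega>. h (\<omega>, \<xi> (Suc n) \<omega>) \<partial>P) =
      (\<integral>\<^sup>+p. h p \<partial>distr P (F n \<Otimes>\<^sub>M \<mu>) (\<lambda>\<omega>. (\<omega>, \<xi> (Suc n) \<omega>)))"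
    by (subst nn_integral_distr[OF pair_innovation_measurable]) auto
  also have "\<dots> = (\<integral>\<^sup>+\<omega>. (\<integral>\<^sup>+s. h (\<omega>, s) \<partial>\<mu>) \<partial>distr P (F n) (\<lambda>\<omega>. \<omega>))"
    unfolding pair_innovation_law by (subst mu.nn_integral_fst) auto
  also have "\<dots> = (\<integral>\<^sup>+\<omega>. (\<integral>\<^sup>+s. h (\<omega>, s) \<partial>\<mu>) \<partial>P)"
    by (subst nn_integral_distr[OF id_measurable_F]) auto
  finally show ?thesis .
qed

lemma integral_innovation:
  fixes h :: "'w \<times> 'e \<Rightarrow> real"
  assumes h [measurable]: "h \<in> borel_measurable (F n \<Otimes>\<^sub>M \<mu>)"
    and int: "integrable P (\<lambda>\<omega>. h (\<omega>, \<xi> (Suc n) \<omega>))"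
  shows "(\<integral>\<omega>. h (\<omega>, \<xi> (Suc n) \<omega>) \<partial>P) = (\<integral>\<omega>. (\<integral>s. h (\<omega>, s) \<partial>\<mu>) \<partial>P)"
proof -
  interpret d: prob_space "distr P (F n) (\<lambda>\<omega>. \<omega>)" by (rule prob_space_distr[OF id_measurable_F])
  interpret pair_sigma_finite "distr P (F n) (\<lambda>\<omega>. \<omega>)" \<mu> ..
  have int': "integrable (distr P (F n) (\<lambda>\<omega>. \<omega>) \<Otimes>\<^sub>M \<mu>) h"
    unfolding pair_innovation_law[symmetric]
    by (subst integrable_distr_eq[OF pair_innovation_measurable]) (auto simp: int)
  have "(\<integral>\<omega>. h (\<omega>, \<xi> (Suc n) \<omega>) \<partial>P) =
      (\<integral>p. h p \<partial>distr P (F n \<Otimes>\<^sub>M \<mu>) (\<lambda>\<omega>. (\<omega>, \<xi> (Suc n) \<omega>)))"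
    by (subst integral_distr[OF pair_innovation_measurable]) auto
  also have "\<dots> = (\<integral>\<omega>. (\<integral>s. h (\<omega>, s) \<partial>\<mu>) \<partial>distr P (F n) (\<lambda>\<omega>. \<omega>))"
    unfolding pair_innovation_law by (rule integral_fst'[OF int', symmetric])
  also have "\<dots> = (\<integral>\<omega>. (\<integral>s. h (\<omega>, s) \<partial>\<mu>) \<partial>P)"
    by (subst integral_distr[OF id_measurable_F]) auto
  finally show ?thesis .
qed

text \<open>
  Subtracting the mean over \<open>s\<close> turns each term into a martingale difference, and by Jensen's
  inequality the centred terms have at most four times the second moments of the original
  ones.
\<close>

theorem innovation_series_AE_convergent:
  fixes h :: "nat \<Rightarrow> 'w \<Rightarrow> 'e \<Rightarrow> real"
  assumes h: "\<And>n. (\<lambda>p. h n (fst p) (snd p)) \<in> borel_measurable (F n \<Otimes>\<^sub>M \<mu>)"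
    and sq: "\<And>n. integrable P (\<lambda>\<omega>. (h n \<omega> (\<xi> (Suc n) \<omega>))\<^sup>2)"
    and summable: "summable (\<lambda>n. \<integral>\<omega>. (h n \<omega> (\<xi> (Suc n) \<omega>))\<^sup>2 \<partial>P)"
  shows "AE \<omega> in P. convergent (\<lambda>n. \<Sum>k<n. h k \<omega> (\<xi> (Suc k) \<omega>) - (\<integral>s. h k \<omega> s \<partial>\<mu>))"
proof -
  define m where "m n \<omega> = (\<integral>s. h n \<omega> s \<partial>\<mu>)" for n \<omega>
  define g where "g n \<omega> s = h n \<omega> s - m n \<omega>" for n \<omega> s
  have m: "m n \<in> borel_measurable (F n)" for n
    unfolding m_def[abs_def] using h[of n]
    by (intro mu.borel_measurable_lebesgue_integral) (simp add: case_prod_beta')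
  note [measurable] = h m
  have mP [measurable]: "m n \<in> borel_measurable P" for n by (rule measurable_F_imp_P[OF m])
  have hs [measurable]: "h n \<omega> \<in> borel_measurable \<mu>" if "\<omega> \<in> space P" for n \<omega>
    using measurable_compose[OF measurable_Pair1'[of \<omega> "F n" \<mu>] h[of n]] that by (simp add: space_F)
  have hP [measurable]: "(\<lambda>\<omega>. h n \<omega> (\<xi> (Suc n) \<omega>)) \<in> borel_measurable P" for n
    using measurable_compose[OF pair_innovation_measurable h[of n]] by simp
  have g [measurable]: "(\<lambda>p. g n (fst p) (snd p)) \<in> borel_measurable (F n \<Otimes>\<^sub>M \<mu>)" for n
    unfolding g_def by measurable
  \<comment> \<open>For non-integrable \<open>h n \<omega>\<close> both integrals take the default value \<open>0\<close>.\<close>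
  have g0: "(\<integral>s. g n \<omega> s \<partial>\<mu>) = 0" if \<omega>: "\<omega> \<in> space P" for n \<omega>
  proof (cases "integrable \<mu> (h n \<omega>)")
    case True
    then show ?thesis unfolding g_def by (simp add: m_def mu.prob_space)
  next
    case False
    have "\<not> integrable \<mu> (g n \<omega>)"
    proof
      assume "integrable \<mu> (g n \<omega>)"
      then have "integrable \<mu> (\<lambda>s. g n \<omega> s + m n \<omega>)" by simp
      then show False using False by (simp add: g_def)
    qed
    then show ?thesis by (rule not_integrable_integral_eq)
  qed
  have jensen: "ennreal ((m n \<omega>)\<^sup>2) \<le> (\<integral>\<^sup>+s. ennreal ((h n \<omega> s)\<^sup>2) \<partial>\<mu>)" if \<omega>: "\<omega> \<in> space P" for n \<omega>
  proof (cases "(\<integral>\<^sup>+s. ennreal ((h n \<omega> s)\<^sup>2) \<partial>\<mu>) = \<infinity>")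
    case False
    then have int2: "integrable \<mu> (\<lambda>s. (h n \<omega> s)\<^sup>2)"
      using hs[OF \<omega>] by (intro integrableI_nonneg) (simp_all add: less_top)
    have int: "integrable \<mu> (h n \<omega>)"
      by (rule mu.square_integrable_imp_integrable[OF hs[OF \<omega>] int2])
    have "0 \<le> (\<integral>s. (h n \<omega> s)\<^sup>2 \<partial>\<mu>) - (m n \<omega>)\<^sup>2"
      using mu.variance_eq[OF int int2] mu.variance_positive[of "h n \<omega>"] by (simp add: m_def)
    then have "ennreal ((m n \<omega>)\<^sup>2) \<le> ennreal (\<integral>s. (h n \<omega> s)\<^sup>2 \<partial>\<mu>)"
      by (intro ennreal_leI) simp
    also have "\<dots> = (\<integral>\<^sup>+s. ennreal ((h n \<omega> s)\<^sup>2) \<partial>\<mu>)"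
      by (rule nn_integral_eq_integral[OF int2, symmetric]) simp
    finally show ?thesis .
  qed simp
  have nn_m: "(\<integral>\<^sup>+\<omega>. ennreal ((m n \<omega>)\<^sup>2) \<partial>P) \<le> ennreal (\<integral>\<omega>. (h n \<omega> (\<xi> (Suc n) \<omega>))\<^sup>2 \<partial>P)" for n
  proof -
    have "(\<integral>\<^sup>+\<omega>. ennreal ((m n \<omega>)\<^sup>2) \<partial>P) \<le> (\<integral>\<^sup>+\<omega>. (\<integral>\<^sup>+s. ennreal ((h n \<omega> s)\<^sup>2) \<partial>\<mu>) \<partial>P)"
      using jensen by (rule nn_integral_mono)
    also have "\<dots> = (\<integral>\<^sup>+\<omega>. ennreal ((h n \<omega> (\<xi> (Suc n) \<omega>))\<^sup>2) \<partial>P)"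
      using nn_integral_innovation[of "\<lambda>p. ennreal ((h n (fst p) (snd p))\<^sup>2)" n] by simp
    also have "\<dots> = ennreal (\<integral>\<omega>. (h n \<omega> (\<xi> (Suc n) \<omega>))\<^sup>2 \<partial>P)"
      by (rule nn_integral_eq_integral[OF sq]) simp
    finally show ?thesis .
  qed
  have m2: "integrable P (\<lambda>\<omega>. (m n \<omega>)\<^sup>2)" for n
    using nn_m[of n] by (intro integrableI_nonneg) (auto simp: le_less_trans)
  have m2_le: "(\<integral>\<omega>. (m n \<omega>)\<^sup>2 \<partial>P) \<le> (\<integral>\<omega>. (h n \<omega> (\<xi> (Suc n) \<omega>))\<^sup>2 \<partial>P)" for n
  proof -
    have "(\<integral>\<^sup>+\<omega>. ennreal ((m n \<omega>)\<^sup>2) \<partial>P) = ennreal (\<integral>\<omega>. (m n \<omega>)\<^sup>2 \<partial>P)"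
      by (rule nn_integral_eq_integral[OF m2]) simp
    then show ?thesis using nn_m[of n] by (simp add: ennreal_le_iff)
  qed
  define D where "D n \<omega> = g n \<omega> (\<xi> (Suc n) \<omega>)" for n \<omega>
  have D_le: "(D n \<omega>)\<^sup>2 \<le> 2 * (h n \<omega> (\<xi> (Suc n) \<omega>))\<^sup>2 + 2 * (m n \<omega>)\<^sup>2" for n \<omega>
    using sum_squares_bound[of "h n \<omega> (\<xi> (Suc n) \<omega>)" "- m n \<omega>"]
    unfolding D_def g_def by (simp add: power2_diff)
  have DP [measurable]: "D n \<in> borel_measurable P" for n unfolding D_def g_def by measurable
  have D2: "integrable P (\<lambda>\<omega>. (D n \<omega>)\<^sup>2)" for n
  proof (rule Bochner_Integration.integrable_bound)
    show "integrable P (\<lambda>\<omega>. 2 * (h n \<omega> (\<xi> (Suc n) \<omega>))\<^sup>2 + 2 * (m n \<omega>)\<^sup>2)"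
      using sq m2 by simp
  qed (use D_le in auto)
  have "AE \<omega> in P. convergent (\<lambda>n. \<Sum>k<n. D k \<omega>)"
  proof (rule martingale_series_AE_convergent[OF subalgebra filtration _ D2])
    fix n
    have "(\<lambda>\<omega>. (\<omega>, \<xi> (Suc n) \<omega>)) \<in> measurable (F (Suc n)) (F n \<Otimes>\<^sub>M \<mu>)"
      using filtration[of n "Suc n"]
      by (intro measurable_Pair innovation_adapted)
        (auto simp: subalgebra_def measurable_def Int_absorb2 sets.sets_into_space)
    from measurable_compose[OF this g[of n]]
    show "D n \<in> borel_measurable (F (Suc n))" by (simp add: D_def[abs_def])
  next
    fix n W
    assume W [measurable]: "W \<in> borel_measurable (F n)" and int: "integrable P (\<lambda>\<omega>. W \<omega> * D n \<omega>)"
    have "(\<integral>\<omega>. W \<omega> * D n \<omega> \<partial>P) = (\<integral>\<omega>. (\<integral>s. W \<omega> * g n \<omega> s \<partial>\<mu>) \<partial>P)"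
      using integral_innovation[of "\<lambda>p. W (fst p) * g n (fst p) (snd p)" n] int by (simp add: D_def)
    also have "\<dots> = (\<integral>\<omega>. 0 \<partial>P)"
      by (rule Bochner_Integration.integral_cong) (auto simp: g0)
    finally show "(\<integral>\<omega>. W \<omega> * D n \<omega> \<partial>P) = 0" by simp
  next
    show "summable (\<lambda>n. \<integral>\<omega>. (D n \<omega>)\<^sup>2 \<partial>P)"
    proof (rule summable_comparison_test'[where N=0])
      show "summable (\<lambda>n. 4 * (\<integral>\<omega>. (h n \<omega> (\<xi> (Suc n) \<omega>))\<^sup>2 \<partial>P))"
        using summable by simp
      fix n :: nat
      have "(\<integral>\<omega>. (D n \<omega>)\<^sup>2 \<partial>P) \<le> (\<integral>\<omega>. 2 * (h n \<omega> (\<xi> (Suc n) \<omega>))\<^sup>2 + 2 * (m n \<omega>)\<^sup>2 \<partial>P)"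
        using D_le D2 sq m2 by (intro integral_mono) auto
      also have "\<dots> = 2 * (\<integral>\<omega>. (h n \<omega> (\<xi> (Suc n) \<omega>))\<^sup>2 \<partial>P) + 2 * (\<integral>\<omega>. (m n \<omega>)\<^sup>2 \<partial>P)"
        using sq m2 by simp
      finally show "norm (\<integral>\<omega>. (D n \<omega>)\<^sup>2 \<partial>P) \<le> 4 * (\<integral>\<omega>. (h n \<omega> (\<xi> (Suc n) \<omega>))\<^sup>2 \<partial>P)"
        using m2_le[of n] by simp
    qed
  qed
  then show ?thesis by (simp add: D_def g_def m_def)
qed

end

lemma subalgebra_vimage_algebra:
  assumes "f \<in> measurable N L" "space N = X"
  shows "subalgebra N (vimage_algebra X f L)"
proof -
  have "f \<in> X \<rightarrow> space L" using assms by (auto simp: measurable_def)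
  then show ?thesis
    using assms by (auto simp: subalgebra_def sets_vimage_algebra2)
qed

text \<open>
  The filtration generated by an i.i.d. sequence: an event of the first \<open>n\<close> variables is a preimage
  under the vector of these variables, which is independent of the next one.
\<close>

lemma (in prob_space) iid_innovations:
  assumes \<mu>: "prob_space \<mu>" and indep: "indep_vars (\<lambda>_. \<mu>) \<xi> {1::nat..}"
    and law: "\<And>n. n \<ge> 1 \<Longrightarrow> distr M \<mu> (\<xi> n) = \<mu>"
  shows "innovations M \<mu>
    (\<lambda>n. vimage_algebra (space M) (\<lambda>\<omega>. \<lambda>i\<in>{1..n}. \<xi> i \<omega>) (Pi\<^sub>M {1..n} (\<lambda>_. \<mu>))) \<xi>"
proof -
  define V where "V n \<omega> = (\<lambda>i\<in>{1..n}. \<xi> i \<omega>)" for n :: nat and \<omega>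
  define F where "F n = vimage_algebra (space M) (V n) (Pi\<^sub>M {1..n} (\<lambda>_. \<mu>))" for n
  have \<xi>: "\<xi> i \<in> measurable M \<mu>" if "i \<ge> 1" for i
    using indep that unfolding indep_vars_def by auto
  have V: "V n \<in> measurable M (Pi\<^sub>M {1..n} (\<lambda>_. \<mu>))" for n
    unfolding V_def[abs_def] by (rule measurable_restrict) (auto intro: \<xi>)
  have VF: "V n \<in> measurable (F n) (Pi\<^sub>M {1..n} (\<lambda>_. \<mu>))" for n
    unfolding F_def using V[of n] by (intro measurable_vimage_algebra1) (auto simp: measurable_def)
  have \<xi>F: "\<xi> i \<in> measurable (F n) \<mu>" if i: "i \<in> {1..n}" for i n
  proof -
    have "(\<lambda>\<omega>. V n \<omega> i) \<in> measurable (F n) \<mu>"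
      using measurable_compose[OF VF measurable_component_singleton[OF i]] .
    then show ?thesis using i by (simp add: V_def)
  qed
  have sub: "subalgebra M (F n)" for n
    unfolding F_def by (rule subalgebra_vimage_algebra[OF V refl])
  have mono: "subalgebra (F n) (F m)" if "m \<le> n" for m n
  proof -
    have "V m \<in> measurable (F n) (Pi\<^sub>M {1..m} (\<lambda>_. \<mu>))"
      unfolding V_def[abs_def] using that by (intro measurable_restrict \<xi>F) auto
    then show ?thesis unfolding F_def[of m]
      by (rule subalgebra_vimage_algebra) (simp add: F_def)
  qed
  have ind: "prob (A \<inter> (\<xi> (Suc n) -` B \<inter> space M)) = prob A * measure \<mu> B"
    if A: "A \<in> sets (F n)" and B: "B \<in> sets \<mu>" for n A B
  proof -
    obtain C where C: "C \<in> sets (Pi\<^sub>M {1..n} (\<lambda>_. \<mu>))" and A_eq: "A = V n -` C \<inter> space M"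
      using A V[of n] unfolding F_def by (subst (asm) sets_vimage_algebra2) (auto simp: measurable_def)
    define E where "E = (\<lambda>f. f (Suc n)) -` B \<inter> space (Pi\<^sub>M {Suc n} (\<lambda>_. \<mu>))"
    define W where "W \<omega> = (\<lambda>i\<in>{Suc n}. \<xi> i \<omega>)" for \<omega>
    have E: "E \<in> sets (Pi\<^sub>M {Suc n} (\<lambda>_. \<mu>))"
      unfolding E_def using B by (intro measurable_sets[OF measurable_component_singleton]) auto
    have "indep_var (Pi\<^sub>M {1..n} (\<lambda>_. \<mu>)) (V n) (Pi\<^sub>M {Suc n} (\<lambda>_. \<mu>)) W"
      unfolding V_def[abs_def] W_def[abs_def] by (rule indep_var_restrict[OF indep]) auto
    from indep_varD[OF this C E]
    have "prob ((\<lambda>\<omega>. (V n \<omega>, W \<omega>)) -` (C \<times> E) \<inter> space M)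
        = prob (V n -` C \<inter> space M) * prob (W -` E \<inter> space M)" .
    moreover have WE: "W -` E \<inter> space M = \<xi> (Suc n) -` B \<inter> space M"
      using \<xi>[of "Suc n"] by (auto simp: W_def E_def space_PiM measurable_def)
    moreover have "(\<lambda>\<omega>. (V n \<omega>, W \<omega>)) -` (C \<times> E) \<inter> space M = A \<inter> (\<xi> (Suc n) -` B \<inter> space M)"
      using WE unfolding A_eq by auto
    moreover have "prob (\<xi> (Suc n) -` B \<inter> space M) = measure \<mu> B"
      using measure_distr[OF \<xi> B, of "Suc n"] law[of "Suc n"] by simp
    ultimately show ?thesis unfolding A_eq by simp
  qed
  interpret mu: prob_space \<mu> by fact
  have "innovations M \<mu> F \<xi>"
    by unfold_locales (auto intro!: sub mono \<xi>F law ind)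
  then show ?thesis by (simp add: F_def[abs_def] V_def[abs_def])
qed

section \<open>Averaged variational inequalities along a fixed trajectory\<close>

text \<open>
  The formulation with real integrals that enters the variational inequality.
\<close>

lemma uniformly_integrable_tail:
  assumes UI: "uniformly_integrable \<mu> I f" and e: "e > 0"
  shows "\<exists>b\<ge>0. \<forall>i\<in>I. integrable \<mu> (\<lambda>s. indicator {s. b < f i s} s * f i s) \<and>
    (\<integral>s. indicator {s. b < f i s} s * f i s \<partial>\<mu>) \<le> e"
proof -
  have m: "f i \<in> borel_measurable \<mu>" and nn: "\<And>s. s \<in> space \<mu> \<Longrightarrow> 0 \<le> f i s" if "i \<in> I" for i
    using UI that unfolding uniformly_integrable_def by auto
  have "((\<lambda>a::real. SUP i\<in>I. \<integral>\<^sup>+ s\<in>{s\<in>space \<mu>. a < f i s}. ennreal (f i s) \<partial>\<mu>) \<longlongrightarrow> 0) at_top"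
    using UI unfolding uniformly_integrable_def by blast
  then have "eventually (\<lambda>a. (SUP i\<in>I. \<integral>\<^sup>+ s\<in>{s\<in>space \<mu>. a < f i s}. ennreal (f i s) \<partial>\<mu>) < ennreal e) at_top"
    by (rule order_tendstoD) (use e in simp)
  then obtain b0 where b0: "\<And>a. a \<ge> b0 \<Longrightarrow>
      (SUP i\<in>I. \<integral>\<^sup>+ s\<in>{s\<in>space \<mu>. a < f i s}. ennreal (f i s) \<partial>\<mu>) < ennreal e"
    unfolding eventually_at_top_linorder by blast
  define b where "b = max b0 0"
  have "integrable \<mu> (\<lambda>s. indicator {s. b < f i s} s * f i s) \<and>
    (\<integral>s. indicator {s. b < f i s} s * f i s \<partial>\<mu>) \<le> e" if i: "i \<in> I" for i
  proof -
    note [measurable] = m[OF i]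
    have "(\<integral>\<^sup>+ s\<in>{s\<in>space \<mu>. b < f i s}. ennreal (f i s) \<partial>\<mu>)
        \<le> (SUP i\<in>I. \<integral>\<^sup>+ s\<in>{s\<in>space \<mu>. b < f i s}. ennreal (f i s) \<partial>\<mu>)"
      using i by (rule SUP_upper)
    also have "\<dots> < ennreal e" by (rule b0) (simp add: b_def)
    also have "(\<integral>\<^sup>+ s\<in>{s\<in>space \<mu>. b < f i s}. ennreal (f i s) \<partial>\<mu>)
        = (\<integral>\<^sup>+ s. ennreal (indicator {s. b < f i s} s * f i s) \<partial>\<mu>)"
      by (rule nn_integral_cong) (auto simp: indicator_def)
    finally have lt: "(\<integral>\<^sup>+ s. ennreal (indicator {s. b < f i s} s * f i s) \<partial>\<mu>) < ennreal e" .
    have nn': "AE s in \<mu>. 0 \<le> indicator {s. b < f i s} s * f i s"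
      using nn[OF i] by (intro AE_I2) auto
    have int: "integrable \<mu> (\<lambda>s. indicator {s. b < f i s} s * f i s)"
      using lt nn' by (intro integrableI_nonneg) (auto elim: less_trans)
    have "ennreal (\<integral>s. indicator {s. b < f i s} s * f i s \<partial>\<mu>) \<le> ennreal e"
      using lt nn_integral_eq_integral[OF int nn'] by simp
    then show ?thesis using int e by (simp add: ennreal_le_iff)
  qed
  then show ?thesis by (intro exI[of _ b]) (auto simp: b_def)
qed

lemma integral_tail_small:
  fixes f g :: "'a \<Rightarrow> real"
  assumes g: "integrable \<mu> g" and f [measurable]: "f \<in> borel_measurable \<mu>" and e: "e > 0"
  shows "\<exists>a\<ge>0. (\<integral>s. indicator {s. a < f s} s * g s \<partial>\<mu>) < e"
proof -
  have [measurable]: "g \<in> borel_measurable \<mu>" using g by simp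
  have "(\<lambda>n. \<integral>s. indicator {s. real n < f s} s * g s \<partial>\<mu>) \<longlonglongrightarrow> (\<integral>s. 0 \<partial>\<mu>)"
  proof (rule integral_dominated_convergence[where w="\<lambda>s. norm (g s)"])
    show "AE s in \<mu>. (\<lambda>n. indicator {s. real n < f s} s * g s) \<longlonglongrightarrow> 0"
    proof (intro AE_I2)
      fix s
      obtain N :: nat where N: "f s \<le> real N" using real_arch_simple by blast
      have "eventually (\<lambda>n. indicator {s. real n < f s} s * g s = 0) sequentially"
        unfolding eventually_sequentially using N by (intro exI[of _ N]) auto
      then show "(\<lambda>n. indicator {s. real n < f s} s * g s) \<longlonglongrightarrow> 0"
        by (rule tendsto_eventually)
    qed
  qed (use g in \<open>auto simp: indicator_def\<close>)
  then have "eventually (\<lambda>n. (\<integral>s. indicator {s. real n < f s} s * g s \<partial>\<mu>) < e) sequentially"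
    using e by (intro order_tendstoD(2)) auto
  then obtain n where "(\<integral>s. indicator {s. real n < f s} s * g s \<partial>\<mu>) < e"
    unfolding eventually_sequentially by blast
  then show ?thesis by (intro exI[of _ "real n"]) simp
qed

lemma weighted_average_const_diff:
  assumes "(\<Sum>k=1..n. l k) \<noteq> 0"
  shows "w - weighted_average l u n = (\<Sum>k=1..n. l k *\<^sub>R (w - u k)) /\<^sub>R (\<Sum>k=1..n. l k)"
  using assms by (simp add: weighted_average_def scaleR_diff_right sum_subtractf
      flip: scaleR_sum_left)

lemma norm_weighted_average_diff_le:
  fixes u :: "nat \<Rightarrow> 'h::real_normed_vector"
  assumes l: "\<And>k. l k > 0" and n: "n \<ge> 1" and R: "\<And>k. norm (u k - w) \<le> R"
  shows "norm (w - weighted_average l u n) \<le> R"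
proof -
  have L: "0 < (\<Sum>k=1..n. l k)" using l n by (intro sum_pos) auto
  have "norm (\<Sum>k=1..n. l k *\<^sub>R (w - u k)) \<le> (\<Sum>k=1..n. l k * R)"
    using l R by (intro order_trans[OF norm_sum] sum_mono)
      (auto simp: norm_minus_commute less_imp_le abs_of_pos intro!: mult_left_mono)
  also have "\<dots> = R * (\<Sum>k=1..n. l k)" by (simp add: sum_distrib_left mult.commute)
  finally show ?thesis using L
    by (subst weighted_average_const_diff) (auto simp: divide_simps)
qed

lemma selections_1D:
  fixes w :: "'h::{real_inner, banach, second_countable_topology}"
  assumes "\<phi> \<in> selections \<mu> A 1 w"
  shows "integrable \<mu> \<phi>" "AE s in \<mu>. \<phi> s \<in> A s w"
proof -
  have "(\<integral>\<^sup>+ s. ennreal (norm (\<phi> s)) \<partial>\<mu>) < \<infinity>"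
    using assms by (simp add: selections_def)
  then show "integrable \<mu> \<phi>"
    using assms by (intro integrableI_bounded) (auto simp: selections_def)
  show "AE s in \<mu>. \<phi> s \<in> A s w" using assms by (simp add: selections_def)
qed

text \<open>
  On \<open>\<parallel>\<phi>(s)\<parallel> \<le> a\<close> monotonicity and \<open>\<langle>\<phi>, y\<rangle> - \<parallel>y\<parallel>\<^sup>2 \<le> \<parallel>\<phi>\<parallel>\<^sup>2/4\<close> reduce the error caused by evaluating at
  the resolvent to \<open>\<lambda>\<^sub>k\<^sup>2 a\<^sup>2/4\<close>, a summable quantity, so it disappears after division by
  \<open>\<Sum> \<lambda>\<^sub>k \<longrightarrow> \<infinity>\<close>.  Where \<open>\<parallel>\<phi>(s)\<parallel> > a\<close>, all terms are bounded by a constant times \<open>\<parallel>\<phi>\<parallel>\<close> plus the averaged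
  Yosida norms \<open>N\<close>.  Splitting \<open>N\<close> at a level \<open>b\<close>, the part above \<open>b\<close> is small uniformly in
  \<open>n\<close> by uniform integrability, and the rest is small for large \<open>a\<close>.
\<close>

theorem ergodic_variational_inequality:
  fixes u :: "nat \<Rightarrow> 'h::{real_inner, banach, second_countable_topology}"
  assumes "prob_space \<mu>" and A: "\<And>s. s \<in> space \<mu> \<Longrightarrow> maximal_monotone (A s)"
    and l: "\<And>k. l k > 0"
    and l_inf: "filterlim (\<lambda>n. \<Sum>k=1..n. l k) at_top sequentially"
    and l2: "summable (\<lambda>k. (l k)\<^sup>2)"
    and y_int: "\<And>k. integrable \<mu> (\<lambda>s. yosida (A s) (l k) (u k))"
    and R: "\<And>k. norm (u k - w) \<le> R"
    and UI: "UI_bar \<mu> A l u"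
    and \<phi>: "\<phi> \<in> selections \<mu> A 1 w"
    and K: "\<And>n. (\<Sum>k=1..n. l k * ((\<integral>s. yosida (A s) (l k) (u k) \<partial>\<mu>) \<bullet> (u k - w))) \<le> K"
    and e: "e > 0"
  shows "eventually (\<lambda>n. - e \<le> (\<integral>s. \<phi> s \<partial>\<mu>) \<bullet> (w - weighted_average l u n)) sequentially"
proof -
  interpret prob_space \<mu> by fact
  define y where "y k s = yosida (A s) (l k) (u k)" for k s
  define L where "L n = (\<Sum>k=1..n. l k)" for n :: nat
  define N where "N n s = (\<Sum>k=1..n. l k * norm (y k s)) / L n" for n s
  define q where "q n s = (\<Sum>k=1..n. l k * (y k s \<bullet> (u k - w))) / L n" for n s
  define d where "d n = w - weighted_average l u n" for n
  have L: "0 < L n" if "n \<ge> 1" for n unfolding L_def using l that by (intro sum_pos) auto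
  have y [simp]: "integrable \<mu> (y k)" for k unfolding y_def[abs_def] by (rule y_int)
  note \<phi>_int [simp] = selections_1D(1)[OF \<phi>] and \<phi>_mem = selections_1D(2)[OF \<phi>]
  have [measurable]: "\<phi> \<in> borel_measurable \<mu>" "\<And>k. y k \<in> borel_measurable \<mu>"
    using \<phi>_int y by (blast dest: borel_measurable_integrable)+
  have N_int [simp]: "integrable \<mu> (N n)" for n unfolding N_def by simp
  have q_int [simp]: "integrable \<mu> (q n)" for n unfolding q_def by simp
  have N0: "0 \<le> N n s" if "n \<ge> 1" for n s
    unfolding N_def using l L[OF that] by (intro divide_nonneg_pos sum_nonneg) (auto simp: less_imp_le)
  have "R \<ge> 0" using R[of 0] norm_ge_zero order_trans by blast
  define R1 where "R1 = R + 1"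
  have R1: "R1 > 0" and R_le: "R \<le> R1" using \<open>R \<ge> 0\<close> by (auto simp: R1_def)
  have e4: "0 < e / (4 * R1)" using e R1 by simp
  have "uniformly_integrable \<mu> {1..} N"
    using UI unfolding UI_bar_def N_def y_def L_def .
  then obtain b where b: "b \<ge> 0" "\<And>n. n \<ge> 1 \<Longrightarrow> integrable \<mu> (\<lambda>s. indicator {s. b < N n s} s * N n s)"
    "\<And>n. n \<ge> 1 \<Longrightarrow> (\<integral>s. indicator {s. b < N n s} s * N n s \<partial>\<mu>) \<le> e / (4 * R1)"
    using uniformly_integrable_tail[OF _ e4, of \<mu> "{1..}" N] by auto
  have "integrable \<mu> (\<lambda>s. norm (\<phi> s) + b)" by simp
  then obtain a where a: "a \<ge> 0"
    "(\<integral>s. indicator {s. a < norm (\<phi> s)} s * (norm (\<phi> s) + b) \<partial>\<mu>) < e / (4 * R1)"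
    using integral_tail_small[of \<mu> "\<lambda>s. norm (\<phi> s) + b" "\<lambda>s. norm (\<phi> s)"] e4 by auto
  have a_int: "integrable \<mu> (\<lambda>s. indicator {s. a < norm (\<phi> s)} s * (norm (\<phi> s) + b))"
    by (rule Bochner_Integration.integrable_bound[OF \<open>integrable \<mu> (\<lambda>s. norm (\<phi> s) + b)\<close>])
      (auto simp: indicator_def b)
  define c where "c = a\<^sup>2 / 4 * (\<Sum>k. (l k)\<^sup>2)"
  \<comment> \<open>The inequality holds for almost every \<open>s\<close>, so that the integral over the whole space can be taken; the
    last two terms pay for the region where \<open>\<phi>\<close> is large.\<close>
  have pointwise: "0 \<le> \<phi> s \<bullet> d n + q n s + c / L n
      + R1 * (indicator {s. a < norm (\<phi> s)} s * (norm (\<phi> s) + b))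
      + R1 * (indicator {s. b < N n s} s * N n s)"
    if n: "n \<ge> 1" and s: "s \<in> space \<mu>" and \<phi>s: "\<phi> s \<in> A s w" for n s
  proof (cases "a < norm (\<phi> s)")
    case False
    have summand: "0 \<le> l k * (\<phi> s \<bullet> (w - u k)) + l k * (y k s \<bullet> (u k - w)) + (l k)\<^sup>2 * (a\<^sup>2 / 4)" for k
    proof -
      have "0 \<le> (\<phi> s - y k s) \<bullet> (w - resolvent (A s) (l k) (u k))"
        unfolding y_def by (intro maximal_monotoneD[OF A[OF s]] \<phi>s yosida_mem[OF A[OF s] l])
      also have "\<dots> = \<phi> s \<bullet> (w - u k) + y k s \<bullet> (u k - w) + l k * (\<phi> s \<bullet> y k s - y k s \<bullet> y k s)"
        unfolding y_def resolvent_eq_yosida[OF A[OF s] l] by (simp add: inner_simps algebra_simps)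
      also have "\<phi> s \<bullet> y k s - y k s \<bullet> y k s \<le> a\<^sup>2 / 4"
      proof -
        have "0 \<le> ((1/2) *\<^sub>R \<phi> s - y k s) \<bullet> ((1/2) *\<^sub>R \<phi> s - y k s)" by simp
        moreover have "\<phi> s \<bullet> \<phi> s \<le> a\<^sup>2"
          using False by (simp add: not_less power_mono flip: power2_norm_eq_inner)
        ultimately show ?thesis by (simp add: inner_simps inner_commute algebra_simps)
      qed
      finally have "0 \<le> \<phi> s \<bullet> (w - u k) + y k s \<bullet> (u k - w) + l k * (a\<^sup>2 / 4)"
        using l[of k] by (simp add: mult_left_mono)
      then have "0 \<le> l k * (\<phi> s \<bullet> (w - u k) + y k s \<bullet> (u k - w) + l k * (a\<^sup>2 / 4))"
        using l[of k] by (intro mult_nonneg_nonneg) auto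
      then show ?thesis by (simp add: power2_eq_square algebra_simps)
    qed
    have "0 \<le> (\<Sum>k=1..n. l k * (\<phi> s \<bullet> (w - u k)) + l k * (y k s \<bullet> (u k - w)) + (l k)\<^sup>2 * (a\<^sup>2 / 4))"
      by (intro sum_nonneg summand)
    also have "\<dots> = (\<Sum>k=1..n. l k * (\<phi> s \<bullet> (w - u k))) + (\<Sum>k=1..n. l k * (y k s \<bullet> (u k - w)))
        + (\<Sum>k=1..n. (l k)\<^sup>2) * (a\<^sup>2 / 4)"
      by (simp add: sum.distrib sum_distrib_right)
    also have "(\<Sum>k=1..n. l k * (\<phi> s \<bullet> (w - u k))) = L n * (\<phi> s \<bullet> d n)"
      using L[OF n] unfolding d_def L_def
      by (subst weighted_average_const_diff) (auto simp: inner_sum_right)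
    also have "(\<Sum>k=1..n. l k * (y k s \<bullet> (u k - w))) = L n * q n s"
      using L[OF n] by (simp add: q_def)
    also have "(\<Sum>k=1..n. (l k)\<^sup>2) * (a\<^sup>2 / 4) \<le> c"
      unfolding c_def using sum_le_suminf[OF l2, of "{1..n}"]
      by (subst mult.commute) (intro mult_left_mono, auto)
    finally have "0 \<le> L n * (\<phi> s \<bullet> d n) + L n * q n s + c" by simp
    then have "0 \<le> L n * (\<phi> s \<bullet> d n + q n s + c / L n)"
      using L[OF n] by (simp add: algebra_simps)
    then have "0 \<le> \<phi> s \<bullet> d n + q n s + c / L n" using L[OF n] by (simp add: zero_le_mult_iff)
    moreover have "0 \<le> R1 * (indicator {s. b < N n s} s * N n s)"
      using R1 N0[OF n] by simp
    ultimately show ?thesis using False by simp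
  next
    case True
    have "\<bar>\<phi> s \<bullet> d n\<bar> \<le> norm (\<phi> s) * norm (d n)" by (rule Cauchy_Schwarz_ineq2)
    also have "\<dots> \<le> norm (\<phi> s) * R1"
      using norm_weighted_average_diff_le[of l n u w R, OF l n R] R_le unfolding d_def
      by (intro mult_left_mono) auto
    finally have 1: "\<bar>\<phi> s \<bullet> d n\<bar> \<le> R1 * norm (\<phi> s)" by (simp add: mult.commute)
    have "\<bar>\<Sum>k=1..n. l k * (y k s \<bullet> (u k - w))\<bar> \<le> (\<Sum>k=1..n. R1 * (l k * norm (y k s)))"
    proof (rule order_trans[OF sum_abs sum_mono])
      fix k
      have "\<bar>y k s \<bullet> (u k - w)\<bar> \<le> norm (y k s) * norm (u k - w)" by (rule Cauchy_Schwarz_ineq2)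
      also have "\<dots> \<le> norm (y k s) * R1"
        using R[of k] R_le by (intro mult_left_mono) auto
      finally show "\<bar>l k * (y k s \<bullet> (u k - w))\<bar> \<le> R1 * (l k * norm (y k s))"
        using l[of k] by (simp add: abs_mult mult.commute mult.left_commute mult_left_mono)
    qed
    then have "\<bar>\<Sum>k=1..n. l k * (y k s \<bullet> (u k - w))\<bar> \<le> R1 * (\<Sum>k=1..n. l k * norm (y k s))"
      by (simp add: sum_distrib_left)
    then have 2: "\<bar>q n s\<bar> \<le> R1 * N n s"
      using L[OF n] by (simp add: q_def N_def divide_right_mono)
    have 3: "0 \<le> c / L n" unfolding c_def using L[OF n] l2
      by (intro divide_nonneg_pos mult_nonneg_nonneg suminf_nonneg) auto
    have "N n s \<le> b + indicator {s. b < N n s} s * N n s"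
      using b(1) by (auto simp: indicator_def)
    then have "R1 * N n s \<le> R1 * b + R1 * (indicator {s. b < N n s} s * N n s)"
      using R1 by (simp add: mult_left_mono flip: distrib_left)
    then show ?thesis using 1 2 3 True by (simp add: distrib_left)
  qed
  have integrated: "- (K / L n) - c / L n - e / 2 \<le> (\<integral>s. \<phi> s \<partial>\<mu>) \<bullet> d n" if n: "n \<ge> 1" for n
  proof -
    have "0 \<le> (\<integral>s. \<phi> s \<bullet> d n + q n s + c / L n
        + R1 * (indicator {s. a < norm (\<phi> s)} s * (norm (\<phi> s) + b))
        + R1 * (indicator {s. b < N n s} s * N n s) \<partial>\<mu>)"
      using \<phi>_mem pointwise[OF n] AE_space[of \<mu>] by (intro integral_nonneg_AE) auto
    also have "\<dots> = (\<integral>s. \<phi> s \<partial>\<mu>) \<bullet> d n + (\<integral>s. q n s \<partial>\<mu>) + c / L n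
        + R1 * (\<integral>s. indicator {s. a < norm (\<phi> s)} s * (norm (\<phi> s) + b) \<partial>\<mu>)
        + R1 * (\<integral>s. indicator {s. b < N n s} s * N n s \<partial>\<mu>)"
      using a_int b(2)[OF n] by (simp add: prob_space)
    also have "(\<integral>s. q n s \<partial>\<mu>) = (\<Sum>k=1..n. l k * ((\<integral>s. y k s \<partial>\<mu>) \<bullet> (u k - w))) / L n"
      unfolding q_def by simp
    also have "\<dots> \<le> K / L n"
      unfolding y_def using K[of n] L[OF n] by (simp add: divide_right_mono)
    also have "R1 * (\<integral>s. indicator {s. a < norm (\<phi> s)} s * (norm (\<phi> s) + b) \<partial>\<mu>) \<le> R1 * (e / (4 * R1))"
      using a(2) R1 by (intro mult_left_mono) auto
    also have "R1 * (\<integral>s. indicator {s. b < N n s} s * N n s \<partial>\<mu>) \<le> R1 * (e / (4 * R1))"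
      using b(3)[OF n] R1 by (intro mult_left_mono) auto
    also have "R1 * (e / (4 * R1)) = e / 4" using R1 by simp
    finally show ?thesis by simp
  qed
  have "filterlim L at_top sequentially" using l_inf by (simp add: L_def[abs_def])
  then have "(\<lambda>n. (K + c) / L n) \<longlonglongrightarrow> 0"
    by (intro real_tendsto_divide_at_top[OF tendsto_const])
  then have "eventually (\<lambda>n. (K + c) / L n < e / 2) sequentially"
    using e by (intro order_tendstoD(2)) auto
  then show ?thesis using eventually_ge_at_top[of 1]
  proof eventually_elim
    case (elim n)
    then show ?case using integrated[of n] by (simp add: d_def add_divide_distrib)
  qed
qed

section \<open>Weak convergence of weighted averages\<close>

lemma weighted_Cesaro_mean:
  fixes c :: "nat \<Rightarrow> real"
  assumes l: "\<And>k. l k > 0" and l_inf: "filterlim (\<lambda>n. \<Sum>k=1..n. l k) at_top sequentially"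
    and c: "c \<longlonglongrightarrow> a"
  shows "(\<lambda>n. (\<Sum>k=1..n. l k * c k) / (\<Sum>k=1..n. l k)) \<longlonglongrightarrow> a"
proof (rule LIMSEQ_I)
  fix e :: real assume e: "e > 0"
  obtain N where N: "\<And>k. k \<ge> N \<Longrightarrow> \<bar>c k - a\<bar> < e / 2"
    using LIMSEQ_D[OF c, of "e / 2"] e by auto
  define B where "B = (\<Sum>k=1..N. l k * \<bar>c k - a\<bar>)"
  have "eventually (\<lambda>n. max 0 (2 * B / e) < (\<Sum>k=1..n. l k)) sequentially"
    using l_inf[unfolded filterlim_at_top_dense] ..
  then obtain M where M: "\<And>n. n \<ge> M \<Longrightarrow> max 0 (2 * B / e) < (\<Sum>k=1..n. l k)"
    unfolding eventually_sequentially by blast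
  show "\<exists>n0. \<forall>n\<ge>n0. norm ((\<Sum>k=1..n. l k * c k) / (\<Sum>k=1..n. l k) - a) < e"
  proof (intro exI allI impI)
    fix n assume "M \<le> n"
    define L where "L = (\<Sum>k=1..n. l k)"
    have L: "0 < L" "2 * B / e < L" using M[OF \<open>M \<le> n\<close>] by (auto simp: L_def)
    have "(\<Sum>k=1..n. l k * c k) / L - a = ((\<Sum>k=1..n. l k * c k) - L * a) / L"
      using L(1) by (simp add: field_simps)
    also have "(\<Sum>k=1..n. l k * c k) - L * a = (\<Sum>k=1..n. l k * (c k - a))"
      unfolding L_def by (simp add: sum_distrib_right right_diff_distrib sum_subtractf)
    finally have eq: "(\<Sum>k=1..n. l k * c k) / L - a = (\<Sum>k=1..n. l k * (c k - a)) / L" .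
    have "\<bar>\<Sum>k=1..n. l k * (c k - a)\<bar>
        \<le> (\<Sum>k=1..n. (if k \<in> {1..N} then l k * \<bar>c k - a\<bar> else 0) + l k * (e / 2))"
    proof (rule order_trans[OF sum_abs sum_mono])
      fix k assume k: "k \<in> {1..n}"
      show "\<bar>l k * (c k - a)\<bar> \<le> (if k \<in> {1..N} then l k * \<bar>c k - a\<bar> else 0) + l k * (e / 2)"
      proof (cases "k \<le> N")
        case True
        then show ?thesis using k l[of k] e by (simp add: abs_mult)
      next
        case False
        then have "\<bar>c k - a\<bar> \<le> e / 2" using N[of k] by simp
        then have "l k * \<bar>c k - a\<bar> \<le> l k * (e / 2)" using l[of k] by (intro mult_left_mono) auto
        then show ?thesis using False l[of k] by (simp add: abs_mult)
      qed
    qed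
    also have "\<dots> = (\<Sum>k\<in>{1..n} \<inter> {1..N}. l k * \<bar>c k - a\<bar>) + L * (e / 2)"
      by (simp only: sum.inter_restrict[OF finite_atLeastAtMost] L_def sum.distrib sum_distrib_right)
    also have "(\<Sum>k\<in>{1..n} \<inter> {1..N}. l k * \<bar>c k - a\<bar>) \<le> B"
      unfolding B_def using l by (intro sum_mono2) (auto simp: less_imp_le)
    also have "B + L * (e / 2) < L * e" using L(2) e by (simp add: field_simps)
    finally have "\<bar>\<Sum>k=1..n. l k * (c k - a)\<bar> < L * e" by simp
    then have "\<bar>(\<Sum>k=1..n. l k * c k) / L - a\<bar> < e"
      unfolding eq using L(1) by (simp add: field_simps)
    then show "norm ((\<Sum>k=1..n. l k * c k) / (\<Sum>k=1..n. l k) - a) < e" by (simp add: L_def)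
  qed
qed

text \<open>
  For \<open>z, z' \<in> Z\<close> the difference of the squared distances is affine in \<open>x n\<close>, so
  \<open>\<langle>x n, z' - z\<rangle>\<close> converges and so do its weighted means \<open>\<langle>w n, z' - z\<rangle>\<close>.  If \<open>z\<close> and \<open>z'\<close> are
  both weak limit points of the averages \<open>w\<close>, the limit equals \<open>\<langle>z, z' - z\<rangle>\<close> and \<open>\<langle>z', z' - z\<rangle>\<close>,
  which forces \<open>z = z'\<close>.
\<close>

theorem ergodic_Opial:
  fixes x :: "nat \<Rightarrow> 'h::{real_inner, banach, second_countable_topology}"
  assumes l: "\<And>k. l k > 0" and l_inf: "filterlim (\<lambda>n. \<Sum>k=1..n. l k) at_top sequentially"
    and Z: "Z \<noteq> {}" and dist: "\<And>z. z \<in> Z \<Longrightarrow> convergent (\<lambda>n. norm (x n - z))"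
    and cluster: "\<And>r z. strict_mono r \<Longrightarrow> weakly_converges (weighted_average l x \<circ> r) z \<Longrightarrow> z \<in> Z"
  shows "\<exists>z\<in>Z. weakly_converges (weighted_average l x) z"
proof -
  obtain z0 where z0: "z0 \<in> Z" using Z by blast
  obtain R where R: "\<And>n. norm (x n - z0) \<le> R"
    using convergent_imp_Bseq[OF dist[OF z0]] unfolding Bseq_def by auto
  define w where "w = weighted_average l x"
  have "norm (w n) \<le> norm z0 + R" if "n \<ge> 1" for n
    using norm_weighted_average_diff_le[of l n x z0 R, OF l that R] norm_triangle_ineq4[of z0 "z0 - w n"]
    by (simp add: w_def)
  moreover have "w 0 = 0" by (simp add: w_def weighted_average_def)
  moreover have "0 \<le> R" using R[of 0] norm_ge_zero order_trans by blast
  ultimately have w_bd: "norm (w n) \<le> norm z0 + R" for n by (cases n) auto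
  have unique: "z = z'"
    if r: "strict_mono r" "weakly_converges (w \<circ> r) z" and r': "strict_mono r'" "weakly_converges (w \<circ> r') z'"
    for r r' z z'
  proof -
    have zZ: "z \<in> Z" "z' \<in> Z" using cluster r r' unfolding w_def by blast+
    obtain d d' where d: "(\<lambda>n. norm (x n - z)) \<longlonglongrightarrow> d" "(\<lambda>n. norm (x n - z')) \<longlonglongrightarrow> d'"
      using dist[OF zZ(1)] dist[OF zZ(2)] unfolding convergent_def by blast
    define a where "a = (d\<^sup>2 - d'\<^sup>2 - (z \<bullet> z - z' \<bullet> z')) / 2"
    have "(\<lambda>n. ((norm (x n - z))\<^sup>2 - (norm (x n - z'))\<^sup>2 - (z \<bullet> z - z' \<bullet> z')) / 2) \<longlonglongrightarrow> a"
      unfolding a_def by (intro tendsto_intros d) auto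
    moreover have "((norm (x n - z))\<^sup>2 - (norm (x n - z'))\<^sup>2 - (z \<bullet> z - z' \<bullet> z')) / 2 = x n \<bullet> (z' - z)" for n
      by (simp add: power2_norm_eq_inner inner_simps inner_commute)
    ultimately have "(\<lambda>n. x n \<bullet> (z' - z)) \<longlonglongrightarrow> a" by simp
    from weighted_Cesaro_mean[of l, OF l l_inf this]
    have a: "(\<lambda>n. w n \<bullet> (z' - z)) \<longlonglongrightarrow> a"
      by (simp add: w_def weighted_average_def inner_sum_left divide_inverse mult.commute)
    have "z \<bullet> (z' - z) = a"
      using LIMSEQ_unique[OF _ LIMSEQ_subseq_LIMSEQ[OF a r(1)]] r(2)
      unfolding weakly_converges_iff_inner by (simp add: o_def)
    moreover have "z' \<bullet> (z' - z) = a"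
      using LIMSEQ_unique[OF _ LIMSEQ_subseq_LIMSEQ[OF a r'(1)]] r'(2)
      unfolding weakly_converges_iff_inner by (simp add: o_def)
    ultimately have "(z' - z) \<bullet> (z' - z) = 0" by (simp add: inner_diff_left)
    then show "z = z'" by simp
  qed
  have subseq: "\<exists>r z. strict_mono (r :: nat \<Rightarrow> nat) \<and> weakly_converges (w \<circ> s \<circ> r) z" for s
  proof -
    have "bounded (range (w \<circ> s))" using w_bd by (auto simp: bounded_iff)
    then show ?thesis by (rule bounded_imp_weakly_convergent_subseq)
  qed
  obtain r z where r: "strict_mono r" "weakly_converges (w \<circ> r) z" using subseq[of id] by auto
  have "(\<lambda>n. w n \<bullet> h) \<longlonglongrightarrow> z \<bullet> h" for h
  proof (rule ccontr)
    assume "\<not> (\<lambda>n. w n \<bullet> h) \<longlonglongrightarrow> z \<bullet> h"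
    then obtain e where e: "e > 0" "\<And>N. \<exists>n\<ge>N. e \<le> dist (w n \<bullet> h) (z \<bullet> h)"
      unfolding lim_sequentially by (auto simp: not_less)
    define I where "I = {n. e \<le> dist (w n \<bullet> h) (z \<bullet> h)}"
    have I: "infinite I" unfolding I_def infinite_nat_iff_unbounded_le using e(2) by blast
    obtain r' z' where r': "strict_mono r'" "weakly_converges (w \<circ> enumerate I \<circ> r') z'"
      using subseq by blast
    have "strict_mono (enumerate I \<circ> r')"
      using strict_mono_enumerate[OF I] r'(1) by (rule strict_mono_o)
    then have "z' = z" using unique[OF _ _ r] r'(2) by (metis o_assoc)
    then have "(\<lambda>n. w (enumerate I (r' n)) \<bullet> h) \<longlonglongrightarrow> z \<bullet> h"
      using r'(2) unfolding weakly_converges_iff_inner by (simp add: o_def)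
    then obtain n where "dist (w (enumerate I (r' n)) \<bullet> h) (z \<bullet> h) < e"
      using e(1) unfolding lim_sequentially by blast
    moreover have "enumerate I (r' n) \<in> I" by (rule enumerate_in_set[OF I])
    ultimately show False by (simp add: I_def)
  qed
  then have "weakly_converges w z" unfolding weakly_converges_iff_inner by blast
  moreover have "z \<in> Z" using cluster r unfolding w_def by blast
  ultimately show ?thesis unfolding w_def by blast
qed

lemma distance_convergent_closure:
  fixes x :: "nat \<Rightarrow> 'a::real_normed_vector"
  assumes D: "\<And>d. d \<in> D \<Longrightarrow> convergent (\<lambda>n. norm (x n - d))" and z: "z \<in> closure D"
  shows "convergent (\<lambda>n. norm (x n - z))"
proof -
  have "Cauchy (\<lambda>n. norm (x n - z))" unfolding Cauchy_altdef2
  proof (intro allI impI)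
    fix e :: real assume e: "e > 0"
    obtain d where d: "d \<in> D" "dist d z < e / 3"
      using z e unfolding closure_approachable by (meson divide_pos_pos zero_less_numeral)
    have close: "\<bar>norm (x n - z) - norm (x n - d)\<bar> < e / 3" for n
      using norm_triangle_ineq3[of "x n - z" "x n - d"] d(2) by (simp add: dist_norm)
    have "Cauchy (\<lambda>n. norm (x n - d))" using D[OF d(1)] convergent_Cauchy by blast
    then obtain N where N: "\<And>n. n \<ge> N \<Longrightarrow> dist (norm (x n - d)) (norm (x N - d)) < e / 3"
      unfolding Cauchy_altdef2 using e by (metis divide_pos_pos zero_less_numeral)
    have "dist (norm (x n - z)) (norm (x N - z)) < e" if "n \<ge> N" for n
      using close[of n] close[of N] N[OF that] unfolding dist_real_def by linarith
    then show "\<exists>N. \<forall>n\<ge>N. dist (norm (x n - z)) (norm (x N - z)) < e" by blast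
  qed
  then show ?thesis by (rule Cauchy_convergent)
qed

lemma convergent_norm_if_sq:
  fixes x :: "nat \<Rightarrow> 'a::real_normed_vector"
  assumes "convergent (\<lambda>n. (norm (x n))\<^sup>2)"
  shows "convergent (\<lambda>n. norm (x n))"
proof -
  obtain a where "(\<lambda>n. (norm (x n))\<^sup>2) \<longlonglongrightarrow> a" using assms convergent_def by blast
  from tendsto_real_sqrt[OF this] show ?thesis by (auto simp: convergent_def)
qed

section \<open>The stochastic proximal point iteration\<close>

text \<open>
  Expand \<open>\<parallel>x - z\<parallel>\<^sup>2\<close> around the new point \<open>x - l y\<close>, where \<open>y\<close> is the Yosida approximation, and
  use monotonicity in the form \<open>\<langle>y - p, x - l y - z\<rangle> \<ge> 0\<close>.  The cross term \<open>2 l\<^sup>2 \<langle>p, y\<rangle>\<close> is split by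
  Young's inequality, which keeps half of \<open>\<parallel>l y\<parallel>\<^sup>2\<close>, the squared length of the step.
\<close>

lemma proximal_step_estimate:
  fixes B :: "'h::{real_inner, banach, second_countable_topology} \<Rightarrow> 'h set"
  assumes B: "maximal_monotone B" and l: "l > 0" and p: "p \<in> B z"
  shows "(norm (resolvent B l x - z))\<^sup>2 + (norm (resolvent B l x - x))\<^sup>2 / 2
    \<le> (norm (x - z))\<^sup>2 - 2 * (l * (p \<bullet> (x - z))) + 2 * l\<^sup>2 * (norm p)\<^sup>2"
proof -
  define y where "y = yosida B l x"
  have J: "resolvent B l x = x - l *\<^sub>R y" unfolding y_def by (rule resolvent_eq_yosida[OF B l])
  have "0 \<le> (y - p) \<bullet> (resolvent B l x - z)"
    unfolding y_def by (intro maximal_monotoneD[OF B] yosida_mem[OF B l] p)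
  then have "0 \<le> 2 * l * ((y - p) \<bullet> (x - l *\<^sub>R y - z))" using l unfolding J by simp
  moreover have "0 \<le> (2 *\<^sub>R p - y) \<bullet> (2 *\<^sub>R p - y) * (l\<^sup>2 / 2)" by simp
  ultimately show ?thesis unfolding J
    by (simp add: power2_norm_eq_inner inner_simps inner_commute power2_eq_square[of l] algebra_simps)
qed

lemma (in prob_space) AE_summable:
  fixes f :: "nat \<Rightarrow> 'a \<Rightarrow> real"
  assumes f: "\<And>n. integrable M (f n)" and nn: "\<And>n x. 0 \<le> f n x"
    and sum: "summable (\<lambda>n. \<integral>x. f n x \<partial>M)"
  shows "AE x in M. summable (\<lambda>n. f n x)"
proof -
  have [measurable]: "f n \<in> borel_measurable M" for n using f by (rule borel_measurable_integrable)
  have "(\<integral>\<^sup>+x. (\<Sum>n. ennreal (f n x)) \<partial>M) = (\<Sum>n. \<integral>\<^sup>+x. ennreal (f n x) \<partial>M)"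
    by (rule nn_integral_suminf) measurable
  also have "\<dots> = (\<Sum>n. ennreal (\<integral>x. f n x \<partial>M))"
    by (intro suminf_cong nn_integral_eq_integral f) (auto simp: nn)
  also have "\<dots> = ennreal (\<Sum>n. \<integral>x. f n x \<partial>M)"
    by (intro suminf_ennreal2 sum) (auto simp: nn)
  finally have "(\<integral>\<^sup>+x. (\<Sum>n. ennreal (f n x)) \<partial>M) \<noteq> \<infinity>" by simp
  then have "AE x in M. (\<Sum>n. ennreal (f n x)) \<noteq> \<infinity>"
    by (intro nn_integral_noteq_infinite) measurable
  then show ?thesis by eventually_elim (auto intro!: summable_suminf_not_top simp: nn)
qed

text \<open>
  Subtracting the partial sums of \<open>c\<close> leaves a decreasing sequence that is bounded below.  In the
  application the perturbations contain martingale differences, whose series may converge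
  only conditionally.
\<close>

lemma quasi_decreasing_convergent:
  fixes b c :: "nat \<Rightarrow> real"
  assumes nn: "\<And>n. 0 \<le> b n" and step: "\<And>n. b (Suc n) \<le> b n + c n"
    and conv: "convergent (\<lambda>n. \<Sum>k<n. c k)"
  shows "convergent b"
proof -
  define a where "a n = b n - (\<Sum>k<n. c k)" for n
  obtain B where B: "\<And>n. \<bar>\<Sum>k<n. c k\<bar> \<le> B"
    using convergent_imp_Bseq[OF conv] unfolding Bseq_def real_norm_def by blast
  have "decseq a" unfolding decseq_Suc_iff using step by (simp add: a_def algebra_simps)
  moreover have "- B \<le> a n" for n using nn[of n] B[of n] unfolding a_def by linarith
  ultimately have "convergent a" using decseq_convergent convergent_def by metis
  then have "convergent (\<lambda>n. a n + (\<Sum>k<n. c k))" by (intro convergent_add conv)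
  then show ?thesis by (simp add: a_def)
qed

text \<open>
  Approximate the second argument by the first point of a dense sequence within distance
  \<open>1/(n + 1)\<close>, a choice that is measurable and takes countably many values.
\<close>

lemma borel_measurable_Caratheodory:
  fixes f :: "'a \<Rightarrow> 'b::{metric_space, second_countable_topology} \<Rightarrow> 'c::metric_space"
  assumes meas [measurable]: "\<And>y. (\<lambda>s. f s y) \<in> borel_measurable M"
    and cont: "\<And>s. s \<in> space M \<Longrightarrow> continuous_on UNIV (f s)"
  shows "(\<lambda>p. f (fst p) (snd p)) \<in> borel_measurable (M \<Otimes>\<^sub>M borel)"
proof -
  obtain D :: "'b set" where D: "countable D" "\<And>X. open X \<Longrightarrow> X \<noteq> {} \<Longrightarrow> \<exists>d\<in>D. d \<in> X"
    using countable_dense_setE by blast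
  have "D \<noteq> {}" using D(2)[of UNIV] by auto
  define d where "d = from_nat_into D"
  have rd: "range d = D" using D(1) \<open>D \<noteq> {}\<close> by (simp add: d_def range_from_nat_into)
  define k where "k n y = (LEAST i. dist (d i) y < inverse (real (Suc n)))" for n y
  have k: "dist (d (k n y)) y < inverse (real (Suc n))" for n y
  proof -
    have "\<exists>i. dist (d i) y < inverse (real (Suc n))"
      using D(2)[of "ball y (inverse (real (Suc n)))"] rd by (auto simp: dist_commute)
    then show ?thesis unfolding k_def by (rule LeastI_ex)
  qed
  have [measurable]: "k n \<in> measurable borel (count_space UNIV)" for n
    unfolding k_def by measurable
  show ?thesis
  proof (rule borel_measurable_LIMSEQ_metric)
    fix n
    show "(\<lambda>p. f (fst p) (d (k n (snd p)))) \<in> borel_measurable (M \<Otimes>\<^sub>M borel)"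
      by (rule measurable_compose_countable[where g="\<lambda>p. k n (snd p)"]) measurable
  next
    fix p assume "p \<in> space (M \<Otimes>\<^sub>M (borel :: 'b measure))"
    then have s: "fst p \<in> space M" by (auto simp: space_pair_measure)
    have "(\<lambda>n. d (k n (snd p))) \<longlonglongrightarrow> snd p"
    proof (rule metric_tendsto_imp_tendsto[OF LIMSEQ_inverse_real_of_nat])
      show "\<forall>\<^sub>F n in sequentially. dist (d (k n (snd p))) (snd p) \<le> dist (inverse (real (Suc n))) 0"
        using k by (auto intro!: always_eventually less_imp_le)
    qed
    then show "(\<lambda>n. f (fst p) (d (k n (snd p)))) \<longlonglongrightarrow> f (fst p) (snd p)"
      using cont[OF s] by (intro continuous_on_tendsto_compose[OF cont[OF s]]) auto
  qed
qed

text \<open>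
  Maximality is required at every \<open>s\<close>, because the joint measurability of
  \<open>(s, y) \<mapsto> J(s, y)\<close> relies on continuity in \<open>y\<close> for every \<open>s\<close>.
\<close>

locale stochastic_proximal = innovations P \<mu> F \<xi>
  for P :: "'w measure" and \<mu> :: "'e measure" and F \<xi> +
  fixes A :: "'e \<Rightarrow> 'h::{real_inner, banach, second_countable_topology} \<Rightarrow> 'h set"
    and lam :: "nat \<Rightarrow> real" and x0 :: 'h and x :: "nat \<Rightarrow> 'w \<Rightarrow> 'h"
  assumes A: "\<And>s. s \<in> space \<mu> \<Longrightarrow> maximal_monotone (A s)"
    and resolvent_measurable: "\<And>l y. l > 0 \<Longrightarrow> (\<lambda>s. resolvent (A s) l y) \<in> borel_measurable \<mu>"
    and lam_pos: "\<And>n. lam n > 0"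
    and lam_sq: "summable (\<lambda>n. (lam n)\<^sup>2)"
    and x_0: "\<And>\<omega>. \<omega> \<in> space P \<Longrightarrow> x 0 \<omega> = x0"
    and x_Suc: "\<And>n \<omega>. \<omega> \<in> space P \<Longrightarrow>
      x (Suc n) \<omega> = resolvent (A (\<xi> (Suc n) \<omega>)) (lam n) (x n \<omega>)"
begin

lemma resolvent_jointly_measurable:
  assumes l: "l > 0"
  shows "(\<lambda>p. resolvent (A (fst p)) l (snd p)) \<in> borel_measurable (\<mu> \<Otimes>\<^sub>M borel)"
proof (rule borel_measurable_Caratheodory)
  fix s assume s: "s \<in> space \<mu>"
  show "continuous_on UNIV (resolvent (A s) l)"
    unfolding continuous_on_iff dist_norm
    using resolvent_nonexpansive[OF A[OF s] l] by (meson le_less_trans)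
qed (rule resolvent_measurable[OF l])

lemma x_adapted: "x n \<in> borel_measurable (F n)"
proof (induction n)
  case 0
  have "x 0 \<in> borel_measurable (F 0) \<longleftrightarrow> (\<lambda>_. x0) \<in> borel_measurable (F 0)"
    by (rule measurable_cong) (simp add: space_F x_0)
  then show ?case by simp
next
  case (Suc n)
  have "x n \<in> borel_measurable (F (Suc n))" using measurable_F_mono[OF Suc] by simp
  then have "(\<lambda>\<omega>. (\<xi> (Suc n) \<omega>, x n \<omega>)) \<in> measurable (F (Suc n)) (\<mu> \<Otimes>\<^sub>M borel)"
    by (intro measurable_Pair innovation_adapted)
  from measurable_compose[OF this resolvent_jointly_measurable[OF lam_pos[of n]]]
  have "(\<lambda>\<omega>. resolvent (A (\<xi> (Suc n) \<omega>)) (lam n) (x n \<omega>)) \<in> borel_measurable (F (Suc n))"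
    by simp
  moreover have "x (Suc n) \<in> borel_measurable (F (Suc n)) \<longleftrightarrow>
      (\<lambda>\<omega>. resolvent (A (\<xi> (Suc n) \<omega>)) (lam n) (x n \<omega>)) \<in> borel_measurable (F (Suc n))"
    by (rule measurable_cong) (simp add: space_F x_Suc)
  ultimately show ?case by simp
qed

lemma x_measurable [measurable]: "x n \<in> borel_measurable P"
  by (rule measurable_F_imp_P[OF x_adapted])

lemma innovation_space: "\<omega> \<in> space P \<Longrightarrow> \<xi> (Suc n) \<omega> \<in> space \<mu>"
  using innovation_measurable[of n] by (auto simp: measurable_def)

lemma AE_innovation: "AE s in \<mu>. Q s \<Longrightarrow> AE \<omega> in P. Q (\<xi> (Suc n) \<omega>)"
  by (rule AE_distrD[OF innovation_measurable[of n], unfolded innovation_law])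

lemma yosida_pair_measurable:
  "(\<lambda>p. yosida (A (snd p)) (lam n) (x n (fst p))) \<in> borel_measurable (F n \<Otimes>\<^sub>M \<mu>)"
proof -
  note [measurable] = x_adapted
  have x': "(\<lambda>p. x n (fst p)) \<in> borel_measurable (F n \<Otimes>\<^sub>M \<mu>)" by measurable
  then have "(\<lambda>p. (snd p, x n (fst p))) \<in> measurable (F n \<Otimes>\<^sub>M \<mu>) (\<mu> \<Otimes>\<^sub>M borel)"
    by (intro measurable_Pair measurable_snd)
  from measurable_compose[OF this resolvent_jointly_measurable[OF lam_pos[of n]]]
  show ?thesis using x' unfolding yosida_def by simp
qed

lemma yosida_measurable:
  assumes "l > 0"
  shows "(\<lambda>s. yosida (A s) l y) \<in> borel_measurable \<mu>"
  using resolvent_measurable[OF assms, of y] unfolding yosida_def by simp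

lemma step_eq_yosida:
  assumes "\<omega> \<in> space P"
  shows "lam n *\<^sub>R yosida (A (\<xi> (Suc n) \<omega>)) (lam n) (x n \<omega>) = x n \<omega> - x (Suc n) \<omega>"
  using resolvent_eq_yosida[OF A[OF innovation_space[OF assms]] lam_pos] x_Suc[OF assms] by simp

lemma yosida_integrable:
  assumes l: "l > 0" and \<phi>: "integrable \<mu> \<phi>" and mem: "AE s in \<mu>. \<phi> s \<in> A s z"
  shows "integrable \<mu> (\<lambda>s. yosida (A s) l y)"
proof (rule Bochner_Integration.integrable_bound)
  show "integrable \<mu> (\<lambda>s. norm (\<phi> s) + 2 * norm (y - z) / l)" using \<phi> by simp
  show "AE s in \<mu>. norm (yosida (A s) l y) \<le> norm (norm (\<phi> s) + 2 * norm (y - z) / l)"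
    using mem AE_space
  proof eventually_elim
    case (elim s)
    then show ?case using norm_yosida_le[OF A l, of s "\<phi> s" z y] by simp
  qed
qed (rule yosida_measurable[OF l])

context
  fixes z :: 'h and \<phi> :: "'e \<Rightarrow> 'h"
  assumes \<phi>_selection: "\<phi> \<in> selections \<mu> A 2 z" and \<phi>_zero: "(\<integral>s. \<phi> s \<partial>\<mu>) = 0"
begin

lemma \<phi>_measurable [measurable]: "\<phi> \<in> borel_measurable \<mu>"
  and \<phi>_mem: "AE s in \<mu>. \<phi> s \<in> A s z"
  using \<phi>_selection by (auto simp: selections_def)

lemma \<phi>_sq_integrable: "integrable \<mu> (\<lambda>s. (norm (\<phi> s))\<^sup>2)"
proof -
  have "(\<integral>\<^sup>+ s. ennreal ((norm (\<phi> s))\<^sup>2) \<partial>\<mu>) = (\<integral>\<^sup>+ s. ennreal (norm (\<phi> s) powr 2) \<partial>\<mu>)"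
    by (rule nn_integral_cong) simp
  also have "\<dots> < \<infinity>" using \<phi>_selection by (simp add: selections_def)
  finally show ?thesis by (intro integrableI_nonneg) auto
qed

lemma \<phi>_integrable: "integrable \<mu> \<phi>"
  using mu.square_integrable_imp_integrable[OF _ \<phi>_sq_integrable] by (simp add: integrable_norm_iff)

definition "selection_energy = (\<integral>s. (norm (\<phi> s))\<^sup>2 \<partial>\<mu>)"

lemma \<phi>_innovation_sq:
  "integrable P (\<lambda>\<omega>. (norm (\<phi> (\<xi> (Suc n) \<omega>)))\<^sup>2)"
  "(\<integral>\<omega>. (norm (\<phi> (\<xi> (Suc n) \<omega>)))\<^sup>2 \<partial>P) = selection_energy"
proof -
  have 1: "integrable (distr P \<mu> (\<xi> (Suc n))) (\<lambda>s. (norm (\<phi> s))\<^sup>2)"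
    using \<phi>_sq_integrable by (simp add: innovation_law)
  show "integrable P (\<lambda>\<omega>. (norm (\<phi> (\<xi> (Suc n) \<omega>)))\<^sup>2)"
    using integrable_distr[OF innovation_measurable 1] .
  have "(\<integral>\<omega>. (norm (\<phi> (\<xi> (Suc n) \<omega>)))\<^sup>2 \<partial>P) = (\<integral>s. (norm (\<phi> s))\<^sup>2 \<partial>distr P \<mu> (\<xi> (Suc n)))"
    by (subst integral_distr[OF innovation_measurable]) auto
  then show "(\<integral>\<omega>. (norm (\<phi> (\<xi> (Suc n) \<omega>)))\<^sup>2 \<partial>P) = selection_energy"
    by (simp add: innovation_law selection_energy_def)
qed

definition "selection_increment n \<omega> s = lam n * (\<phi> s \<bullet> (x n \<omega> - z))"

lemma selection_increment_measurable: "(\<lambda>p. selection_increment n (fst p) (snd p)) \<in> borel_measurable (F n \<Otimes>\<^sub>M \<mu>)"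
proof -
  note [measurable] = x_adapted
  show ?thesis unfolding selection_increment_def by measurable
qed

lemma selection_increment_innovation_measurable [measurable]: "(\<lambda>\<omega>. selection_increment n \<omega> (\<xi> (Suc n) \<omega>)) \<in> borel_measurable P"
  using measurable_compose[OF pair_innovation_measurable selection_increment_measurable[of n]] by simp

lemma selection_increment_mean_zero: "(\<integral>s. selection_increment n \<omega> s \<partial>\<mu>) = 0"
  unfolding selection_increment_def using \<phi>_integrable \<phi>_zero by simp

lemma selection_increment_sq:
  assumes int: "integrable P (\<lambda>\<omega>. (norm (x n \<omega> - z))\<^sup>2)"
  shows "integrable P (\<lambda>\<omega>. (selection_increment n \<omega> (\<xi> (Suc n) \<omega>))\<^sup>2)"
    and "(\<integral>\<omega>. (selection_increment n \<omega> (\<xi> (Suc n) \<omega>))\<^sup>2 \<partial>P) \<le> (lam n)\<^sup>2 * (selection_energy * (\<integral>\<omega>. (norm (x n \<omega> - z))\<^sup>2 \<partial>P))"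
proof -
  note [measurable] = x_adapted selection_increment_measurable
  define a where "a = (\<integral>\<omega>. (norm (x n \<omega> - z))\<^sup>2 \<partial>P)"
  have a0: "0 \<le> a" and energy_nonneg: "0 \<le> selection_energy" unfolding a_def selection_energy_def by simp_all
  have "(\<integral>\<^sup>+\<omega>. ennreal ((selection_increment n \<omega> (\<xi> (Suc n) \<omega>))\<^sup>2) \<partial>P)
      = (\<integral>\<^sup>+\<omega>. (\<integral>\<^sup>+s. ennreal ((selection_increment n \<omega> s)\<^sup>2) \<partial>\<mu>) \<partial>P)"
    using nn_integral_innovation[of "\<lambda>p. ennreal ((selection_increment n (fst p) (snd p))\<^sup>2)" n] by simp
  also have "\<dots> \<le> (\<integral>\<^sup>+\<omega>. (\<integral>\<^sup>+s. ennreal ((lam n)\<^sup>2 * (norm (x n \<omega> - z))\<^sup>2) * ennreal ((norm (\<phi> s))\<^sup>2) \<partial>\<mu>) \<partial>P)"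
  proof (intro nn_integral_mono)
    fix \<omega> s
    have "\<bar>selection_increment n \<omega> s\<bar> \<le> lam n * (norm (x n \<omega> - z) * norm (\<phi> s))"
      unfolding selection_increment_def abs_mult using lam_pos[of n] Cauchy_Schwarz_ineq2[of "\<phi> s" "x n \<omega> - z"]
      by (simp add: mult.commute mult_left_mono)
    then have "(selection_increment n \<omega> s)\<^sup>2 \<le> (lam n * (norm (x n \<omega> - z) * norm (\<phi> s)))\<^sup>2"
      by (metis abs_ge_zero power2_abs power_mono)
    also have "\<dots> = (lam n)\<^sup>2 * (norm (x n \<omega> - z))\<^sup>2 * (norm (\<phi> s))\<^sup>2"
      by (simp add: power_mult_distrib)
    finally show "ennreal ((selection_increment n \<omega> s)\<^sup>2)
        \<le> ennreal ((lam n)\<^sup>2 * (norm (x n \<omega> - z))\<^sup>2) * ennreal ((norm (\<phi> s))\<^sup>2)"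
      by (simp add: ennreal_leI flip: ennreal_mult)
  qed
  also have "\<dots> = (\<integral>\<^sup>+\<omega>. ennreal ((lam n)\<^sup>2 * (norm (x n \<omega> - z))\<^sup>2) * ennreal selection_energy \<partial>P)"
    unfolding selection_energy_def
    by (subst nn_integral_eq_integral[OF \<phi>_sq_integrable, symmetric])
      (auto intro!: nn_integral_cong nn_integral_cmult)
  also have "\<dots> = (\<integral>\<^sup>+\<omega>. ennreal ((lam n)\<^sup>2 * selection_energy * (norm (x n \<omega> - z))\<^sup>2) \<partial>P)"
    using energy_nonneg by (intro nn_integral_cong) (simp add: mult_ac flip: ennreal_mult)
  also have "\<dots> = ennreal ((lam n)\<^sup>2 * selection_energy * a)"
    using energy_nonneg int by (subst nn_integral_eq_integral) (auto simp: a_def)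
  finally have le: "(\<integral>\<^sup>+\<omega>. ennreal ((selection_increment n \<omega> (\<xi> (Suc n) \<omega>))\<^sup>2) \<partial>P) \<le> ennreal ((lam n)\<^sup>2 * selection_energy * a)" .
  show int': "integrable P (\<lambda>\<omega>. (selection_increment n \<omega> (\<xi> (Suc n) \<omega>))\<^sup>2)"
    using le by (intro integrableI_nonneg) (auto simp: le_less_trans)
  have "ennreal (\<integral>\<omega>. (selection_increment n \<omega> (\<xi> (Suc n) \<omega>))\<^sup>2 \<partial>P) \<le> ennreal ((lam n)\<^sup>2 * selection_energy * a)"
    using le nn_integral_eq_integral[OF int'] by simp
  then show "(\<integral>\<omega>. (selection_increment n \<omega> (\<xi> (Suc n) \<omega>))\<^sup>2 \<partial>P) \<le> (lam n)\<^sup>2 * (selection_energy * (\<integral>\<omega>. (norm (x n \<omega> - z))\<^sup>2 \<partial>P))"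
    using a0 energy_nonneg by (simp add: ennreal_le_iff a_def mult.assoc)
qed

text \<open>
  Up to a martingale difference and a summable error, the distance to the zero \<open>z\<close> decreases.
\<close>

lemma Fejer_inequality:
  "AE \<omega> in P. \<forall>n. (norm (x (Suc n) \<omega> - z))\<^sup>2 + (norm (x (Suc n) \<omega> - x n \<omega>))\<^sup>2 / 2
    \<le> (norm (x n \<omega> - z))\<^sup>2 - 2 * selection_increment n \<omega> (\<xi> (Suc n) \<omega>) + 2 * (lam n)\<^sup>2 * (norm (\<phi> (\<xi> (Suc n) \<omega>)))\<^sup>2"
  unfolding AE_all_countable
proof
  fix n
  show "AE \<omega> in P. (norm (x (Suc n) \<omega> - z))\<^sup>2 + (norm (x (Suc n) \<omega> - x n \<omega>))\<^sup>2 / 2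
    \<le> (norm (x n \<omega> - z))\<^sup>2 - 2 * selection_increment n \<omega> (\<xi> (Suc n) \<omega>) + 2 * (lam n)\<^sup>2 * (norm (\<phi> (\<xi> (Suc n) \<omega>)))\<^sup>2"
    using AE_innovation[OF \<phi>_mem, of n] AE_space
  proof eventually_elim
    case (elim \<omega>)
    then show ?case
      using proximal_step_estimate[OF A[OF innovation_space[of \<omega> n]] lam_pos[of n],
          of "\<phi> (\<xi> (Suc n) \<omega>)" z "x n \<omega>"]
      unfolding selection_increment_def by (simp add: x_Suc)
  qed
qed

text \<open>
  Expectation of the preceding inequality; the increment has mean zero because \<open>\<phi>\<close> does.
\<close>

lemma moment_step:
  assumes int: "integrable P (\<lambda>\<omega>. (norm (x n \<omega> - z))\<^sup>2)"
  shows "integrable P (\<lambda>\<omega>. (norm (x (Suc n) \<omega> - z))\<^sup>2)"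
    and "integrable P (\<lambda>\<omega>. (norm (x (Suc n) \<omega> - x n \<omega>))\<^sup>2)"
    and "(\<integral>\<omega>. (norm (x (Suc n) \<omega> - z))\<^sup>2 \<partial>P) + (\<integral>\<omega>. (norm (x (Suc n) \<omega> - x n \<omega>))\<^sup>2 \<partial>P) / 2
      \<le> (\<integral>\<omega>. (norm (x n \<omega> - z))\<^sup>2 \<partial>P) + 2 * selection_energy * (lam n)\<^sup>2"
proof -
  have h_int: "integrable P (\<lambda>\<omega>. selection_increment n \<omega> (\<xi> (Suc n) \<omega>))"
    by (rule square_integrable_imp_integrable[OF selection_increment_innovation_measurable selection_increment_sq(1)[OF int]])
  have h0: "(\<integral>\<omega>. selection_increment n \<omega> (\<xi> (Suc n) \<omega>) \<partial>P) = 0"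
    using integral_innovation[OF selection_increment_measurable[of n]] h_int by (simp add: selection_increment_mean_zero)
  define rhs where "rhs \<omega> = (norm (x n \<omega> - z))\<^sup>2 - 2 * selection_increment n \<omega> (\<xi> (Suc n) \<omega>)
      + 2 * (lam n)\<^sup>2 * (norm (\<phi> (\<xi> (Suc n) \<omega>)))\<^sup>2" for \<omega>
  have rhs: "integrable P rhs" unfolding rhs_def using int h_int \<phi>_innovation_sq(1) by simp
  have le: "AE \<omega> in P. (norm (x (Suc n) \<omega> - z))\<^sup>2 + (norm (x (Suc n) \<omega> - x n \<omega>))\<^sup>2 / 2 \<le> rhs \<omega>"
    using Fejer_inequality unfolding rhs_def by eventually_elim blast
  show i1: "integrable P (\<lambda>\<omega>. (norm (x (Suc n) \<omega> - z))\<^sup>2)"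
  proof (rule Bochner_Integration.integrable_bound[OF rhs])
    show "AE \<omega> in P. norm ((norm (x (Suc n) \<omega> - z))\<^sup>2) \<le> norm (rhs \<omega>)"
      using le
    proof eventually_elim
      case (elim \<omega>)
      then show ?case using zero_le_power2[of "norm (x (Suc n) \<omega> - x n \<omega>)"]
          abs_ge_self[of "rhs \<omega>"] unfolding real_norm_def abs_power2 by linarith
    qed
  qed measurable
  have rhs2: "integrable P (\<lambda>\<omega>. 2 * rhs \<omega>)" using rhs by simp
  show i2: "integrable P (\<lambda>\<omega>. (norm (x (Suc n) \<omega> - x n \<omega>))\<^sup>2)"
  proof (rule Bochner_Integration.integrable_bound[OF rhs2])
    show "AE \<omega> in P. norm ((norm (x (Suc n) \<omega> - x n \<omega>))\<^sup>2) \<le> norm (2 * rhs \<omega>)"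
      using le
    proof eventually_elim
      case (elim \<omega>)
      then show ?case using zero_le_power2[of "norm (x (Suc n) \<omega> - z)"]
          abs_ge_self[of "2 * rhs \<omega>"] unfolding real_norm_def abs_power2 by linarith
    qed
  qed measurable
  have "(\<integral>\<omega>. (norm (x (Suc n) \<omega> - z))\<^sup>2 \<partial>P) + (\<integral>\<omega>. (norm (x (Suc n) \<omega> - x n \<omega>))\<^sup>2 \<partial>P) / 2
      = (\<integral>\<omega>. (norm (x (Suc n) \<omega> - z))\<^sup>2 + (norm (x (Suc n) \<omega> - x n \<omega>))\<^sup>2 / 2 \<partial>P)"
    using i1 i2 by simp
  also have "\<dots> \<le> (\<integral>\<omega>. rhs \<omega> \<partial>P)"
    using i1 i2 rhs le by (intro integral_mono_AE) auto
  also have "\<dots> = (\<integral>\<omega>. (norm (x n \<omega> - z))\<^sup>2 \<partial>P) + 2 * selection_energy * (lam n)\<^sup>2"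
    unfolding rhs_def using int h_int h0 \<phi>_innovation_sq[of n] by simp
  finally show "(\<integral>\<omega>. (norm (x (Suc n) \<omega> - z))\<^sup>2 \<partial>P) + (\<integral>\<omega>. (norm (x (Suc n) \<omega> - x n \<omega>))\<^sup>2 \<partial>P) / 2
      \<le> (\<integral>\<omega>. (norm (x n \<omega> - z))\<^sup>2 \<partial>P) + 2 * selection_energy * (lam n)\<^sup>2" .
qed

lemma x_sq_integrable: "integrable P (\<lambda>\<omega>. (norm (x n \<omega> - z))\<^sup>2)"
proof (induction n)
  case 0
  have "integrable P (\<lambda>\<omega>. (norm (x 0 \<omega> - z))\<^sup>2) \<longleftrightarrow> integrable P (\<lambda>\<omega>. (norm (x0 - z))\<^sup>2)"
    by (rule Bochner_Integration.integrable_cong) (auto simp: x_0)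
  then show ?case by simp
qed (rule moment_step(1))

lemma moment_sum:
  "(\<integral>\<omega>. (norm (x n \<omega> - z))\<^sup>2 \<partial>P) + (\<Sum>k<n. \<integral>\<omega>. (norm (x (Suc k) \<omega> - x k \<omega>))\<^sup>2 \<partial>P) / 2
    \<le> (\<integral>\<omega>. (norm (x 0 \<omega> - z))\<^sup>2 \<partial>P) + 2 * selection_energy * (\<Sum>k. (lam k)\<^sup>2)"
proof -
  have energy_nonneg: "0 \<le> selection_energy" unfolding selection_energy_def by simp
  have "(\<integral>\<omega>. (norm (x n \<omega> - z))\<^sup>2 \<partial>P) + (\<Sum>k<n. \<integral>\<omega>. (norm (x (Suc k) \<omega> - x k \<omega>))\<^sup>2 \<partial>P) / 2
    \<le> (\<integral>\<omega>. (norm (x 0 \<omega> - z))\<^sup>2 \<partial>P) + 2 * selection_energy * (\<Sum>k<n. (lam k)\<^sup>2)"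
  proof (induction n)
    case (Suc n)
    then show ?case using moment_step(3)[OF x_sq_integrable, of n]
      unfolding sum.lessThan_Suc distrib_left add_divide_distrib by linarith
  qed simp
  also have "\<dots> \<le> (\<integral>\<omega>. (norm (x 0 \<omega> - z))\<^sup>2 \<partial>P) + 2 * selection_energy * (\<Sum>k. (lam k)\<^sup>2)"
    using energy_nonneg lam_sq by (intro add_left_mono mult_left_mono sum_le_suminf) auto
  finally show ?thesis .
qed

lemma steps_sq_summable:
  "integrable P (\<lambda>\<omega>. (norm (x (Suc n) \<omega> - x n \<omega>))\<^sup>2)"
  "summable (\<lambda>n. \<integral>\<omega>. (norm (x (Suc n) \<omega> - x n \<omega>))\<^sup>2 \<partial>P)"
proof -
  show "integrable P (\<lambda>\<omega>. (norm (x (Suc n) \<omega> - x n \<omega>))\<^sup>2)"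
    by (rule moment_step(2)[OF x_sq_integrable])
  define a where "a = (\<integral>\<omega>. (norm (x 0 \<omega> - z))\<^sup>2 \<partial>P) + 2 * selection_energy * (\<Sum>k. (lam k)\<^sup>2)"
  have nn: "0 \<le> (\<integral>\<omega>. (norm (x n \<omega> - z))\<^sup>2 \<partial>P)" for n by simp
  show "summable (\<lambda>n. \<integral>\<omega>. (norm (x (Suc n) \<omega> - x n \<omega>))\<^sup>2 \<partial>P)"
  proof (rule summableI_nonneg_bounded)
    fix n
    show "(\<Sum>k<n. \<integral>\<omega>. (norm (x (Suc k) \<omega> - x k \<omega>))\<^sup>2 \<partial>P)
        \<le> 2 * a"
      using moment_sum[of n] nn[of n] unfolding a_def[symmetric] by linarith
  qed simp
qed

text \<open>
  The random perturbations in the Fejer inequality form a convergent series: the increments by the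
  martingale theorem, since their variances are at most a constant times \<open>\<lambda>\<^sub>n\<^sup>2\<close> by the bound on the
  second moments, and the remaining terms because their expectations are summable.
\<close>

theorem AE_distance_convergent: "AE \<omega> in P. convergent (\<lambda>n. (norm (x n \<omega> - z))\<^sup>2)"
proof -
  have energy_nonneg: "0 \<le> selection_energy" unfolding selection_energy_def by simp
  define a where "a = (\<integral>\<omega>. (norm (x 0 \<omega> - z))\<^sup>2 \<partial>P) + 2 * selection_energy * (\<Sum>k. (lam k)\<^sup>2)"
  have x_le: "(\<integral>\<omega>. (norm (x n \<omega> - z))\<^sup>2 \<partial>P) \<le> a" for n
  proof -
    have "0 \<le> (\<Sum>k<n. \<integral>\<omega>. (norm (x (Suc k) \<omega> - x k \<omega>))\<^sup>2 \<partial>P)" by (intro sum_nonneg) simp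
    then show ?thesis using moment_sum[of n] unfolding a_def by linarith
  qed
  have "AE \<omega> in P. convergent (\<lambda>n. \<Sum>k<n. selection_increment k \<omega> (\<xi> (Suc k) \<omega>) - (\<integral>s. selection_increment k \<omega> s \<partial>\<mu>))"
  proof (rule innovation_series_AE_convergent[OF selection_increment_measurable selection_increment_sq(1)[OF x_sq_integrable]])
    show "summable (\<lambda>n. \<integral>\<omega>. (selection_increment n \<omega> (\<xi> (Suc n) \<omega>))\<^sup>2 \<partial>P)"
    proof (rule summable_comparison_test'[where N=0])
      show "summable (\<lambda>n. (lam n)\<^sup>2 * (selection_energy * a))" using lam_sq by (rule summable_mult2)
      fix n :: nat
      have "(\<integral>\<omega>. (selection_increment n \<omega> (\<xi> (Suc n) \<omega>))\<^sup>2 \<partial>P) \<le> (lam n)\<^sup>2 * (selection_energy * (\<integral>\<omega>. (norm (x n \<omega> - z))\<^sup>2 \<partial>P))"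
        by (rule selection_increment_sq(2)[OF x_sq_integrable])
      also have "\<dots> \<le> (lam n)\<^sup>2 * (selection_energy * a)" using energy_nonneg x_le by (intro mult_left_mono) auto
      finally show "norm (\<integral>\<omega>. (selection_increment n \<omega> (\<xi> (Suc n) \<omega>))\<^sup>2 \<partial>P) \<le> (lam n)\<^sup>2 * (selection_energy * a)" by simp
    qed
  qed
  moreover have "AE \<omega> in P. summable (\<lambda>n. (lam n)\<^sup>2 * (norm (\<phi> (\<xi> (Suc n) \<omega>)))\<^sup>2)"
  proof (rule AE_summable)
    show "summable (\<lambda>n. \<integral>\<omega>. (lam n)\<^sup>2 * (norm (\<phi> (\<xi> (Suc n) \<omega>)))\<^sup>2 \<partial>P)"
      using summable_mult2[OF lam_sq, of selection_energy] by (simp add: \<phi>_innovation_sq(2))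
  qed (auto intro: \<phi>_innovation_sq(1))
  ultimately show ?thesis using Fejer_inequality
  proof eventually_elim
    case (elim \<omega>)
    define c where "c n = - 2 * selection_increment n \<omega> (\<xi> (Suc n) \<omega>) + 2 * ((lam n)\<^sup>2 * (norm (\<phi> (\<xi> (Suc n) \<omega>)))\<^sup>2)" for n
    have "convergent (\<lambda>n. - 2 * (\<Sum>k<n. selection_increment k \<omega> (\<xi> (Suc k) \<omega>))
        + 2 * (\<Sum>k<n. (lam k)\<^sup>2 * (norm (\<phi> (\<xi> (Suc k) \<omega>)))\<^sup>2))"
      using elim(1,2) unfolding summable_iff_convergent
      by (intro convergent_add convergent_mult convergent_const) (simp_all add: selection_increment_mean_zero)
    moreover have "(\<Sum>k<n. c k) = - 2 * (\<Sum>k<n. selection_increment k \<omega> (\<xi> (Suc k) \<omega>))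
        + 2 * (\<Sum>k<n. (lam k)\<^sup>2 * (norm (\<phi> (\<xi> (Suc k) \<omega>)))\<^sup>2)" for n
      unfolding c_def sum.distrib sum_distrib_left ..
    ultimately have "convergent (\<lambda>n. \<Sum>k<n. c k)" by simp
    then show ?case
    proof (rule quasi_decreasing_convergent[rotated 2])
      fix n
      have "0 \<le> (norm (x (Suc n) \<omega> - x n \<omega>))\<^sup>2" by simp
      then show "(norm (x (Suc n) \<omega> - z))\<^sup>2 \<le> (norm (x n \<omega> - z))\<^sup>2 + c n"
        using elim(3)[rule_format, of n] unfolding c_def mult.assoc by linarith
    qed simp
  qed
qed

text \<open>
  With the realised innovations in place of the mean over \<open>s\<close>, the sum consists of
  \<open>\<langle>x\<^sub>k - x\<^sub>k\<^sub>+\<^sub>1, x\<^sub>k - u\<rangle>\<close> and telescopes up to the summable \<open>\<parallel>x\<^sub>k\<^sub>+\<^sub>1 - x\<^sub>k\<parallel>\<^sup>2/2\<close>.  The difference is a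
  martingale.  To bound its variance the terms with \<open>\<parallel>x\<^sub>k - u\<parallel> > R\<close> are cut off, a decision that
  depends on the past only; on a trajectory that stays within distance \<open>R\<close> nothing is
  changed.
\<close>

theorem AE_drift_sums_bounded_above:
  "AE \<omega> in P. \<forall>R. (\<forall>n. norm (x n \<omega> - u) \<le> R) \<longrightarrow>
    (\<exists>K. \<forall>n. (\<Sum>k=1..n. lam k * ((\<integral>s. yosida (A s) (lam k) (x k \<omega>) \<partial>\<mu>) \<bullet> (x k \<omega> - u))) \<le> K)"
proof -
  define g where "g R n \<omega> s = (if norm (x n \<omega> - u) \<le> real R
      then lam n * (yosida (A s) (lam n) (x n \<omega>) \<bullet> (x n \<omega> - u)) else 0)" for R n \<omega> s
  have g_meas: "(\<lambda>p. g R n (fst p) (snd p)) \<in> borel_measurable (F n \<Otimes>\<^sub>M \<mu>)" for R n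
  proof -
    note [measurable] = x_adapted yosida_pair_measurable
    show ?thesis unfolding g_def by measurable
  qed
  have gP [measurable]: "(\<lambda>\<omega>. g R n \<omega> (\<xi> (Suc n) \<omega>)) \<in> borel_measurable P" for R n
    using measurable_compose[OF pair_innovation_measurable g_meas[of R n]] by simp
  have g_step: "g R n \<omega> (\<xi> (Suc n) \<omega>) = (x n \<omega> - x (Suc n) \<omega>) \<bullet> (x n \<omega> - u)"
    if "\<omega> \<in> space P" "norm (x n \<omega> - u) \<le> real R" for R n \<omega>
    using that(2) unfolding g_def step_eq_yosida[OF that(1), symmetric] by simp
  have g_le: "(g R n \<omega> (\<xi> (Suc n) \<omega>))\<^sup>2 \<le> (real R)\<^sup>2 * (norm (x (Suc n) \<omega> - x n \<omega>))\<^sup>2"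
    if \<omega>: "\<omega> \<in> space P" for R n \<omega>
  proof (cases "norm (x n \<omega> - u) \<le> real R")
    case True
    have "\<bar>(x n \<omega> - x (Suc n) \<omega>) \<bullet> (x n \<omega> - u)\<bar> \<le> norm (x n \<omega> - x (Suc n) \<omega>) * norm (x n \<omega> - u)"
      by (rule Cauchy_Schwarz_ineq2)
    also have "\<dots> \<le> norm (x n \<omega> - x (Suc n) \<omega>) * real R" using True by (intro mult_left_mono) auto
    finally have "\<bar>g R n \<omega> (\<xi> (Suc n) \<omega>)\<bar> \<le> real R * norm (x (Suc n) \<omega> - x n \<omega>)"
      using g_step[OF \<omega> True] by (simp add: mult.commute norm_minus_commute)
    then have "\<bar>g R n \<omega> (\<xi> (Suc n) \<omega>)\<bar>\<^sup>2 \<le> (real R * norm (x (Suc n) \<omega> - x n \<omega>))\<^sup>2"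
      by (intro power_mono) auto
    then show ?thesis by (simp add: power_mult_distrib)
  qed (simp add: g_def)
  have g_sq: "integrable P (\<lambda>\<omega>. (g R n \<omega> (\<xi> (Suc n) \<omega>))\<^sup>2)" for R n
  proof (rule Bochner_Integration.integrable_bound)
    show "integrable P (\<lambda>\<omega>. (real R)\<^sup>2 * (norm (x (Suc n) \<omega> - x n \<omega>))\<^sup>2)"
      using steps_sq_summable(1) by simp
    show "AE \<omega> in P. norm ((g R n \<omega> (\<xi> (Suc n) \<omega>))\<^sup>2) \<le> norm ((real R)\<^sup>2 * (norm (x (Suc n) \<omega> - x n \<omega>))\<^sup>2)"
      using g_le by (intro AE_I2) simp
  qed measurable
  have martingale: "AE \<omega> in P. convergent (\<lambda>n. \<Sum>k<n. g R k \<omega> (\<xi> (Suc k) \<omega>) - (\<integral>s. g R k \<omega> s \<partial>\<mu>))" for R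
  proof (rule innovation_series_AE_convergent[OF g_meas g_sq])
    show "summable (\<lambda>n. \<integral>\<omega>. (g R n \<omega> (\<xi> (Suc n) \<omega>))\<^sup>2 \<partial>P)"
    proof (rule summable_comparison_test'[where N=0])
      show "summable (\<lambda>n. (real R)\<^sup>2 * (\<integral>\<omega>. (norm (x (Suc n) \<omega> - x n \<omega>))\<^sup>2 \<partial>P))"
        using steps_sq_summable(2) by (rule summable_mult)
      fix n :: nat
      have "(\<integral>\<omega>. (g R n \<omega> (\<xi> (Suc n) \<omega>))\<^sup>2 \<partial>P) \<le> (\<integral>\<omega>. (real R)\<^sup>2 * (norm (x (Suc n) \<omega> - x n \<omega>))\<^sup>2 \<partial>P)"
        using g_sq g_le steps_sq_summable(1) by (intro integral_mono) auto
      then show "norm (\<integral>\<omega>. (g R n \<omega> (\<xi> (Suc n) \<omega>))\<^sup>2 \<partial>P)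
          \<le> (real R)\<^sup>2 * (\<integral>\<omega>. (norm (x (Suc n) \<omega> - x n \<omega>))\<^sup>2 \<partial>P)"
        using steps_sq_summable(1) by simp
    qed
  qed
  have "AE \<omega> in P. \<forall>R. convergent (\<lambda>n. \<Sum>k<n. g R k \<omega> (\<xi> (Suc k) \<omega>) - (\<integral>s. g R k \<omega> s \<partial>\<mu>))"
    unfolding AE_all_countable using martingale by blast
  moreover have "AE \<omega> in P. summable (\<lambda>n. (norm (x (Suc n) \<omega> - x n \<omega>))\<^sup>2)"
    by (rule AE_summable) (auto intro: steps_sq_summable)
  ultimately show ?thesis using AE_space
  proof eventually_elim
    case (elim \<omega>)
    show ?case
    proof (intro allI impI)
      fix R assume R: "\<forall>n. norm (x n \<omega> - u) \<le> R"
      obtain R' :: nat where R': "R \<le> real R'" using real_arch_simple by blast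
      have bd: "norm (x n \<omega> - u) \<le> real R'" for n using R R' order_trans by blast
      have conv: "convergent (\<lambda>n. \<Sum>k<n. g R' k \<omega> (\<xi> (Suc k) \<omega>) - (\<integral>s. g R' k \<omega> s \<partial>\<mu>))"
        using elim(1) by blast
      obtain B where B: "\<And>n. \<bar>\<Sum>k<n. g R' k \<omega> (\<xi> (Suc k) \<omega>) - (\<integral>s. g R' k \<omega> s \<partial>\<mu>)\<bar> \<le> B"
        using convergent_imp_Bseq[OF conv] unfolding Bseq_def real_norm_def by blast
      define Q where "Q = (\<Sum>k. (norm (x (Suc k) \<omega> - x k \<omega>))\<^sup>2)"
      have realised: "(\<Sum>k<n. g R' k \<omega> (\<xi> (Suc k) \<omega>)) \<le> ((norm (x 0 \<omega> - u))\<^sup>2 + Q) / 2" for n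
      proof -
        have "g R' k \<omega> (\<xi> (Suc k) \<omega>) = ((norm (x k \<omega> - u))\<^sup>2 - (norm (x (Suc k) \<omega> - u))\<^sup>2) / 2
            + (norm (x (Suc k) \<omega> - x k \<omega>))\<^sup>2 / 2" for k
          unfolding g_step[OF elim(3) bd] power2_norm_eq_inner
          by (simp add: inner_simps inner_commute field_simps)
        then have "(\<Sum>k<n. g R' k \<omega> (\<xi> (Suc k) \<omega>))
            = (\<Sum>k<n. (norm (x k \<omega> - u))\<^sup>2 - (norm (x (Suc k) \<omega> - u))\<^sup>2) / 2
              + (\<Sum>k<n. (norm (x (Suc k) \<omega> - x k \<omega>))\<^sup>2) / 2"
          by (simp add: sum.distrib sum_divide_distrib)
        also have "\<dots> = ((norm (x 0 \<omega> - u))\<^sup>2 - (norm (x n \<omega> - u))\<^sup>2) / 2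
              + (\<Sum>k<n. (norm (x (Suc k) \<omega> - x k \<omega>))\<^sup>2) / 2"
          by (simp only: sum_lessThan_telescope'[of "\<lambda>k. (norm (x k \<omega> - u))\<^sup>2"])
        also have "\<dots> \<le> ((norm (x 0 \<omega> - u))\<^sup>2 + Q) / 2"
        proof -
          have "(\<Sum>k<n. (norm (x (Suc k) \<omega> - x k \<omega>))\<^sup>2) \<le> Q"
            unfolding Q_def by (intro sum_le_suminf elim(2)) auto
          moreover have "(p - q) / 2 + r / 2 \<le> (p + Q) / 2" if "r \<le> Q" "0 \<le> q" for p q r :: real
            using that by (simp add: field_simps)
          ultimately show ?thesis by simp
        qed
        finally show ?thesis .
      qed
      define f where "f k = lam k * ((\<integral>s. yosida (A s) (lam k) (x k \<omega>) \<partial>\<mu>) \<bullet> (x k \<omega> - u))" for k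
      have f: "(\<integral>s. g R' k \<omega> s \<partial>\<mu>) = f k" for k
        unfolding g_def f_def using bd[of k] yosida_integrable[OF lam_pos \<phi>_integrable \<phi>_mem]
        by simp
      have "(\<Sum>k<Suc n. f k) \<le> ((norm (x 0 \<omega> - u))\<^sup>2 + Q) / 2 + B" for n
        using realised[of "Suc n"] B[of "Suc n"] unfolding f sum_subtractf by linarith
      moreover have "(\<Sum>k<Suc n. f k) = f 0 + (\<Sum>k=1..n. f k)" for n
        by (simp add: lessThan_Suc_atMost atMost_atLeast0 sum.atLeast_Suc_atMost)
      ultimately have "(\<Sum>k=1..n. f k) \<le> ((norm (x 0 \<omega> - u))\<^sup>2 + Q) / 2 + B - f 0" for n
        by (simp add: algebra_simps)
      then show "\<exists>K. \<forall>n. (\<Sum>k=1..n. lam k * ((\<integral>s. yosida (A s) (lam k) (x k \<omega>) \<partial>\<mu>) \<bullet> (x k \<omega> - u))) \<le> K"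
        unfolding f_def by blast
    qed
  qed
qed

end

end

context stochastic_proximal
begin

text \<open>
  Almost surely on \<open>G\<close> the hypotheses of the variational inequality and of the Opial argument hold along the
  trajectory.  The variational inequality for all \<open>(u, v)\<close> in the graph of the mean operator says
  that \<open>(z, 0)\<close> is monotonically related to this graph for every weak limit point \<open>z\<close>, so
  maximality gives \<open>z \<in> zer\<close>.
\<close>

theorem ergodic_convergence:
  assumes lam_inf: "filterlim (\<lambda>n. \<Sum>k=1..n. lam k) at_top sequentially"
    and mean: "maximal_monotone (mean_operator \<mu> A)"
    and nonempty: "zer (mean_operator \<mu> A) \<noteq> {}"
    and zeros: "zer (mean_operator \<mu> A) \<subseteq> selection_zeros \<mu> A 2"
    and UI: "AE \<omega> in P. \<omega> \<in> G \<longrightarrow> UI_bar \<mu> A lam (\<lambda>n. x n \<omega>)"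
  shows "AE \<omega> in P. \<omega> \<in> G \<longrightarrow>
    (\<exists>z\<in>zer (mean_operator \<mu> A). weakly_converges (weighted_average lam (\<lambda>n. x n \<omega>)) z)"
proof -
  define Z where "Z = zer (mean_operator \<mu> A)"
  have selection: "\<exists>\<phi>. \<phi> \<in> selections \<mu> A 2 z \<and> (\<integral>s. \<phi> s \<partial>\<mu>) = 0" if "z \<in> Z" for z
    using that zeros unfolding Z_def selection_zeros_def by blast
  obtain z0 \<phi>0 where z0: "z0 \<in> Z" and \<phi>0: "\<phi>0 \<in> selections \<mu> A 2 z0" "(\<integral>s. \<phi>0 s \<partial>\<mu>) = 0"
    using nonempty selection unfolding Z_def by blast
  \<comment> \<open>Null sets may be discarded only countably often, so both the zeros and the graph of the
    mean operator are replaced by countable dense subsets.\<close>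
  obtain DZ where DZ: "countable DZ" "DZ \<subseteq> Z" "Z \<subseteq> closure DZ" using separable by blast
  define Gr where "Gr = {(u, v). v \<in> mean_operator \<mu> A u}"
  obtain DG where DG: "countable DG" "DG \<subseteq> Gr" "Gr \<subseteq> closure DG" using separable by blast
  have "AE \<omega> in P. \<forall>z\<in>DZ. convergent (\<lambda>n. norm (x n \<omega> - z))"
  proof (rule AE_ball_countable'[OF _ DZ(1)])
    fix z assume "z \<in> DZ"
    then obtain \<phi> where "\<phi> \<in> selections \<mu> A 2 z" "(\<integral>s. \<phi> s \<partial>\<mu>) = 0"
      using DZ(2) selection by blast
    from AE_distance_convergent[OF this]
    show "AE \<omega> in P. convergent (\<lambda>n. norm (x n \<omega> - z))"
      by eventually_elim (rule convergent_norm_if_sq)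
  qed
  moreover have "AE \<omega> in P. \<forall>p\<in>DG. \<forall>R. (\<forall>n. norm (x n \<omega> - fst p) \<le> R) \<longrightarrow>
    (\<exists>K. \<forall>n. (\<Sum>k=1..n. lam k * ((\<integral>s. yosida (A s) (lam k) (x k \<omega>) \<partial>\<mu>) \<bullet> (x k \<omega> - fst p))) \<le> K)"
    by (rule AE_ball_countable'[OF _ DG(1)]) (rule AE_drift_sums_bounded_above[OF \<phi>0])
  ultimately show ?thesis using UI
  proof eventually_elim
    case (elim \<omega>)
    show ?case
    proof
      assume "\<omega> \<in> G"
      then have UI\<omega>: "UI_bar \<mu> A lam (\<lambda>n. x n \<omega>)" using elim(3) by blast
      have dist: "convergent (\<lambda>n. norm (x n \<omega> - z))" if "z \<in> Z" for z
        using distance_convergent_closure[of DZ "\<lambda>n. x n \<omega>" z] elim(1) DZ(3) that by blast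
      obtain R0 where R0: "\<And>n. norm (x n \<omega> - z0) \<le> R0"
        using convergent_imp_Bseq[OF dist[OF z0]] unfolding Bseq_def by auto
      have variational: "eventually (\<lambda>n. - e \<le> v \<bullet> (u - weighted_average lam (\<lambda>n. x n \<omega>) n)) sequentially"
        if uv: "(u, v) \<in> DG" and e: "e > 0" for u v e
      proof -
        obtain \<phi> where \<phi>: "\<phi> \<in> selections \<mu> A 1 u" and v: "v = (\<integral>s. \<phi> s \<partial>\<mu>)"
          using uv DG(2) unfolding Gr_def mean_operator_def by blast
        have R: "norm (x n \<omega> - u) \<le> R0 + norm (z0 - u)" for n
          using norm_triangle_ineq[of "x n \<omega> - z0" "z0 - u"] R0[of n] by simp
        then obtain K where "\<And>n. (\<Sum>k=1..n. lam k *
            ((\<integral>s. yosida (A s) (lam k) (x k \<omega>) \<partial>\<mu>) \<bullet> (x k \<omega> - u))) \<le> K"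
          using bspec[OF elim(2) uv, unfolded fst_conv] by blast
        then show ?thesis unfolding v
          by (intro ergodic_variational_inequality[OF mu.prob_space_axioms A lam_pos lam_inf lam_sq _ R UI\<omega> \<phi> _ e])
            (auto intro: yosida_integrable[OF lam_pos \<phi>_integrable[OF \<phi>0] \<phi>_mem[OF \<phi>0]])
      qed
      have cluster: "z \<in> Z" if r: "strict_mono r"
        and z: "weakly_converges (weighted_average lam (\<lambda>n. x n \<omega>) \<circ> r) z" for r z
      proof -
        have "0 \<le> v \<bullet> (u - z)" if uv: "(u, v) \<in> DG" for u v
        proof -
          have "(\<lambda>n. v \<bullet> (u - weighted_average lam (\<lambda>n. x n \<omega>) (r n))) \<longlonglongrightarrow> v \<bullet> (u - z)"
            using z unfolding weakly_converges_iff_inner inner_diff_right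
            by (intro tendsto_diff tendsto_const) (simp add: inner_commute o_def)
          moreover have "eventually (\<lambda>n. - e \<le> v \<bullet> (u - weighted_average lam (\<lambda>n. x n \<omega>) (r n))) sequentially"
            if "e > 0" for e
            using eventually_subseq[OF r variational[OF uv that]] .
          ultimately have ge: "- e \<le> v \<bullet> (u - z)" if "e > 0" for e
            using that by (intro tendsto_lowerbound) auto
          show ?thesis
          proof (rule field_le_epsilon)
            fix e :: real assume "e > 0"
            then show "0 \<le> v \<bullet> (u - z) + e" using ge[of e] by linarith
          qed
        qed
        then have "DG \<subseteq> {p. 0 \<le> snd p \<bullet> (fst p - z)}" by auto
        moreover have "closed {p. 0 \<le> snd p \<bullet> (fst p - z)}"
          by (intro closed_Collect_le continuous_intros)
        ultimately have "Gr \<subseteq> {p. 0 \<le> snd p \<bullet> (fst p - z)}"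
          using DG(3) closure_minimal by blast
        then have "0 \<le> (v - 0) \<bullet> (u - z)" if "v \<in> mean_operator \<mu> A u" for u v
          using that unfolding Gr_def by auto
        then have "0 \<in> mean_operator \<mu> A z" by (rule maximal_monotone_memI[OF mean])
        then show ?thesis by (simp add: Z_def zer_def)
      qed
      show "\<exists>z\<in>zer (mean_operator \<mu> A). weakly_converges (weighted_average lam (\<lambda>n. x n \<omega>)) z"
        unfolding Z_def[symmetric]
      proof (rule ergodic_Opial[OF lam_pos lam_inf _ dist])
        show "Z \<noteq> {}" using z0 by blast
      qed (auto intro: cluster)
    qed
  qed
qed

end

section \<open>Operators that are maximal only almost everywhere\<close>

lemma maximal_monotone_zero: "maximal_monotone (\<lambda>_::'h::real_inner. {0::'h})"
  unfolding maximal_monotone_def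
proof (intro conjI allI impI)
  show "monotone_operator (\<lambda>_::'h. {0::'h})" by (simp add: monotone_operator_def)
  fix C :: "'h \<Rightarrow> 'h set" assume C: "monotone_operator C \<and> (\<forall>x. {0} \<subseteq> C x)"
  have "v = 0" if "v \<in> C y" for v y
  proof -
    have "0 \<le> (v - 0) \<bullet> (y - (y + v))"
      using C that unfolding monotone_operator_def by blast
    then have "v \<bullet> v \<le> 0" by simp
    then show "v = 0" by (metis inner_eq_zero_iff inner_ge_zero order_antisym)
  qed
  then show "C = (\<lambda>_. {0})" using C by (intro ext) blast
qed

lemma uniformly_integrable_cong_AE:
  assumes UI: "uniformly_integrable \<mu> I f"
    and eq: "\<And>i. i \<in> I \<Longrightarrow> AE s in \<mu>. g i s = f i s"
    and meas: "\<And>i. i \<in> I \<Longrightarrow> g i \<in> borel_measurable \<mu>"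
    and nonneg: "\<And>i s. i \<in> I \<Longrightarrow> s \<in> space \<mu> \<Longrightarrow> 0 \<le> g i s"
  shows "uniformly_integrable \<mu> I g"
proof -
  have "(\<integral>\<^sup>+ s\<in>{s\<in>space \<mu>. a < g i s}. ennreal (g i s) \<partial>\<mu>) = (\<integral>\<^sup>+ s\<in>{s\<in>space \<mu>. a < f i s}. ennreal (f i s) \<partial>\<mu>)"
    if "i \<in> I" for a i
    using eq[OF that] by (intro nn_integral_cong_AE) (auto simp: indicator_def)
  then have "(SUP i\<in>I. \<integral>\<^sup>+ s\<in>{s\<in>space \<mu>. a < g i s}. ennreal (g i s) \<partial>\<mu>)
      = (SUP i\<in>I. \<integral>\<^sup>+ s\<in>{s\<in>space \<mu>. a < f i s}. ennreal (f i s) \<partial>\<mu>)" for a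
    by (intro SUP_cong) auto
  then show ?thesis using UI meas nonneg unfolding uniformly_integrable_def by simp
qed

text \<open>
  Replacing \<open>A s\<close> by the zero operator where it is not maximal changes neither the selections nor,
  almost surely, the iterates and the averaged Yosida norms.  Completeness of \<open>\<mu>\<close> makes the
  exceptional set measurable.
\<close>

theorem theorem2:
  fixes \<mu> :: "'e measure" and P :: "'w measure"
    and A :: "'e \<Rightarrow> 'h::{real_inner, banach, second_countable_topology} \<Rightarrow> 'h set"
    and lam :: "nat \<Rightarrow> real" and \<xi> :: "nat \<Rightarrow> 'w \<Rightarrow> 'e"
    and x0 :: 'h and x :: "nat \<Rightarrow> 'w \<Rightarrow> 'h" and G :: "'w set"
  assumes "prob_space \<mu>" and "complete_measure \<mu>" and "prob_space P"
    and "AE s in \<mu>. maximal_monotone (A s)"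
    and "\<And>l y. l > 0 \<Longrightarrow> (\<lambda>s. resolvent (A s) l y) \<in> borel_measurable \<mu>"
    and "\<And>n. lam n > 0"
    and "filterlim (\<lambda>n. \<Sum>k<n. lam k) at_top sequentially"
    and "summable (\<lambda>n. (lam n)\<^sup>2)"
    and "prob_space.indep_vars P (\<lambda>_. \<mu>) \<xi> {1..}"
    and "\<And>n. n \<ge> 1 \<Longrightarrow> \<xi> n \<in> measurable P \<mu> \<and> distr P \<mu> (\<xi> n) = \<mu>"
    and "maximal_monotone (mean_operator \<mu> A)"
    and "zer (mean_operator \<mu> A) \<noteq> {}"
    and "zer (mean_operator \<mu> A) \<subseteq> selection_zeros \<mu> A 2"
    and "\<And>\<omega>. \<omega> \<in> space P \<Longrightarrow> x 0 \<omega> = x0"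
    and "\<And>n \<omega>. \<omega> \<in> space P \<Longrightarrow> x (Suc n) \<omega> = resolvent (A (\<xi> (Suc n) \<omega>)) (lam n) (x n \<omega>)"
    and "G \<in> sets P"
    and "AE \<omega> in P. \<omega> \<in> G \<longrightarrow> UI_bar \<mu> A lam (\<lambda>n. x n \<omega>)"
  shows "AE \<omega> in P. \<omega> \<in> G \<longrightarrow>
    (\<exists>z\<in>zer (mean_operator \<mu> A). weakly_converges (weighted_average lam (\<lambda>n. x n \<omega>)) z)"
proof -
  interpret mu: prob_space \<mu> by (rule assms(1))
  interpret mu: complete_measure \<mu> by (rule assms(2))
  interpret P: prob_space P by (rule assms(3))
  have lam_pos: "lam n > 0" for n by (rule assms(6))
  have \<xi>: "\<xi> (Suc n) \<in> measurable P \<mu>" "distr P \<mu> (\<xi> (Suc n)) = \<mu>" for n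
    using assms(10)[of "Suc n"] by auto
  \<comment> \<open>On the null set where \<open>A s\<close> is not maximal the resolvent is unspecified; replacing
    \<open>A s\<close> there by the zero operator makes the resolvent jointly measurable.\<close>
  define A' where "A' s = (if maximal_monotone (A s) then A s else (\<lambda>_. {0}))" for s
  have A': "maximal_monotone (A' s)" for s
    unfolding A'_def using maximal_monotone_zero by auto
  have A'_AE: "AE s in \<mu>. A' s = A s"
    using assms(4) by eventually_elim (simp add: A'_def)
  have good: "{s \<in> space \<mu>. maximal_monotone (A s)} \<in> sets \<mu>"
  proof -
    obtain N where N: "N \<in> null_sets \<mu>" "{s \<in> space \<mu>. \<not> maximal_monotone (A s)} \<subseteq> N"
      using assms(4) unfolding eventually_ae_filter by blast
    then have "{s \<in> space \<mu>. \<not> maximal_monotone (A s)} \<in> sets \<mu>" using mu.complete by blast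
    then have "space \<mu> - {s \<in> space \<mu>. \<not> maximal_monotone (A s)} \<in> sets \<mu>" by (rule sets.compl_sets)
    then show ?thesis by (rule back_subst[where P="\<lambda>S. S \<in> sets \<mu>"]) auto
  qed
  have A'_resolvent: "(\<lambda>s. resolvent (A' s) l y) \<in> borel_measurable \<mu>" if l: "l > 0" for l y
  proof -
    have "resolvent (\<lambda>_. {0}) l y = y"
      using resolvent_eqI[OF maximal_monotone_zero l, of 0 y] by simp
    then have "resolvent (A' s) l y = (if maximal_monotone (A s) then resolvent (A s) l y else y)" for s
      by (simp add: A'_def)
    then show ?thesis
      using measurable_If[OF assms(5)[OF l, of y] measurable_const good] by simp
  qed
  have selections_eq: "selections \<mu> A' p y = selections \<mu> A p y" for p y
  proof -
    have "(AE s in \<mu>. \<phi> s \<in> A' s y) \<longleftrightarrow> (AE s in \<mu>. \<phi> s \<in> A s y)" for \<phi>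
      using A'_AE by (intro eventually_cong[OF A'_AE]) auto
    then show ?thesis by (simp add: selections_def)
  qed
  have mean_eq: "mean_operator \<mu> A' = mean_operator \<mu> A"
    by (intro ext) (simp add: mean_operator_def selections_eq)
  have zeros_eq: "selection_zeros \<mu> A' 2 = selection_zeros \<mu> A 2"
    by (simp add: selection_zeros_def selections_eq)
  define x' where "x' n \<omega> = rec_nat x0 (\<lambda>n y. resolvent (A' (\<xi> (Suc n) \<omega>)) (lam n) y) n" for n \<omega>
  define F where "F = (\<lambda>n. vimage_algebra (space P) (\<lambda>\<omega>. \<lambda>i\<in>{1..n}. \<xi> i \<omega>) (Pi\<^sub>M {1..n} (\<lambda>_. \<mu>)))"
  interpret innovations P \<mu> F \<xi>
    unfolding F_def using P.iid_innovations[OF assms(1,9)] assms(10) by blast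
  interpret stochastic_proximal P \<mu> F \<xi> A' lam x0 x'
    by unfold_locales (auto simp: A' A'_resolvent lam_pos assms(8) x'_def)
  have x_eq: "AE \<omega> in P. \<forall>n. x' n \<omega> = x n \<omega>"
  proof -
    have "AE \<omega> in P. \<forall>n. A' (\<xi> (Suc n) \<omega>) = A (\<xi> (Suc n) \<omega>)"
      unfolding AE_all_countable using AE_innovation[OF A'_AE] by blast
    then show ?thesis using AE_space
    proof eventually_elim
      case (elim \<omega>)
      have "x' n \<omega> = x n \<omega>" for n
        by (induction n) (use elim in \<open>simp_all add: x'_def assms(14,15)\<close>)
      then show ?case by blast
    qed
  qed
  have "filterlim (\<lambda>n. \<Sum>k<Suc n. lam k) at_top sequentially"
    using assms(7) by (rule filterlim_compose[OF _ filterlim_Suc])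
  then have "filterlim (\<lambda>n. - lam 0 + (\<Sum>k<Suc n. lam k)) at_top sequentially"
    by (intro filterlim_tendsto_add_at_top[OF tendsto_const])
  moreover have "- lam 0 + (\<Sum>k<Suc n. lam k) = (\<Sum>k=1..n. lam k)" for n
    by (simp add: lessThan_Suc_atMost atMost_atLeast0 sum.atLeast_Suc_atMost)
  ultimately have lam_inf: "filterlim (\<lambda>n. \<Sum>k=1..n. lam k) at_top sequentially" by simp
  have "AE \<omega> in P. \<omega> \<in> G \<longrightarrow> UI_bar \<mu> A' lam (\<lambda>n. x' n \<omega>)"
    using assms(17) x_eq
  proof eventually_elim
    case (elim \<omega>)
    show ?case
    proof
      assume "\<omega> \<in> G"
      then have UI: "UI_bar \<mu> A lam (\<lambda>n. x' n \<omega>)" using elim by simp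
      show "UI_bar \<mu> A' lam (\<lambda>n. x' n \<omega>)" unfolding UI_bar_def
      proof (rule uniformly_integrable_cong_AE[OF UI[unfolded UI_bar_def]])
        fix n :: nat
        show "AE s in \<mu>. (\<Sum>k=1..n. lam k * norm (yosida (A' s) (lam k) (x' k \<omega>))) / (\<Sum>k=1..n. lam k)
            = (\<Sum>k=1..n. lam k * norm (yosida (A s) (lam k) (x' k \<omega>))) / (\<Sum>k=1..n. lam k)"
          using A'_AE by eventually_elim simp
        show "(\<lambda>s. (\<Sum>k=1..n. lam k * norm (yosida (A' s) (lam k) (x' k \<omega>))) / (\<Sum>k=1..n. lam k))
            \<in> borel_measurable \<mu>"
          using yosida_measurable[OF lam_pos] by measurable
        show "0 \<le> (\<Sum>k=1..n. lam k * norm (yosida (A' s) (lam k) (x' k \<omega>))) / (\<Sum>k=1..n. lam k)" for s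
          using lam_pos by (intro divide_nonneg_nonneg sum_nonneg mult_nonneg_nonneg) (auto simp: less_imp_le)
      qed
    qed
  qed
  from ergodic_convergence[OF lam_inf _ _ _ this]
  have "AE \<omega> in P. \<omega> \<in> G \<longrightarrow>
      (\<exists>z\<in>zer (mean_operator \<mu> A). weakly_converges (weighted_average lam (\<lambda>n. x' n \<omega>)) z)"
    using assms(11-13) by (simp add: mean_eq zeros_eq)
  then show ?thesis using x_eq by eventually_elim simp
qed

end
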